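(* Let $\boldsymbol\Phi$ be an irreducible reduced finite root system, let $\mathcal{W}$ be its finite Weyl group with set of simple reflections $\mathcal{S}$, and let $\widetilde{\mathcal{W}}$ be the associated affine Weyl group, with Coxeter generating set $\widetilde{\mathcal{S}}\supset\mathcal{S}$. Then, for every $Q,J,K\subset\mathcal{S}$, the series $p_{Q,J,K}(t)$, ${}^J\widetilde{\mathcal{W}}^K(t)$ and $N_{\widetilde{\mathcal{W}}}(\widetilde{\mathcal{W}}_J)(t)$ are rational functions.
   Context: $\boldsymbol\Phi$ is an irreducible reduced finite (crystallographic) root system spanning a finite-dimensional real vector space $V$, $\langle\cdot,\cdot\rangle:V\times V^\vee\to\mathbb{R}$ is the natural pairing, $\alpha^\vee\in V^\vee$ is the coroot of $\alpha\in\boldsymbol\Phi$, $\Sigma$ is a base of $\boldsymbol\Phi$ and $\widetilde\alpha$ is the highest root. For $\alpha\in\boldsymbol\Phi$, $k\in\mathbb{Z}$, $s_{\alpha,k}$ is the affine reflection $x\mapsto x-(\langle\alpha,x\rangle-k)\alpha^\vee$ of $V^\vee$. $\widetilde{\mathcal{W}}$ is the group generated by all $s_{\alpha,k}$; $\mathcal{S}=\{s_{\alpha,0}\mid\alpha\in\Sigma\}$, $\mathcal{W}=\langle\mathcal{S}\rangle$, and $\widetilde{\mathcal{S}}=\mathcal{S}\cup\{s_{\widetilde\alpha,1}\}$, so that $(\widetilde{\mathcal{W}},\widetilde{\mathcal{S}})$ is a Coxeter system, with length function $\ell$. The symbol $\subset$ allows equality. For $X\subset\widetilde{\mathcal{W}}$,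 $X(t)=\sum_{x\in X}t^{\ell(x)}\in\mathbb{Z}[[t]]$; it is called a rational function if it is the power series expansion of an element of $\mathbb{Q}(t)$. For $J,K\subset\mathcal{S}$: $\widetilde{\mathcal{W}}_J=\langle J\rangle$; ${}^J\widetilde{\mathcal{W}}^K$ is the set of $w\in\widetilde{\mathcal{W}}$ with $\ell(sw)>\ell(w)$ for all $s\in J$ and $\ell(ws)>\ell(w)$ for all $s\in K$ (the minimal length representatives of $(\widetilde{\mathcal{W}}_J,\widetilde{\mathcal{W}}_K)$-double cosets); $p_{Q,J,K}=\{x\in{}^J\widetilde{\mathcal{W}}^K\mid K\cap x^{-1}Jx=Q\}$; $N_{\widetilde{\mathcal{W}}}(\widetilde{\mathcal{W}}_J)$ is the normalizer of $\widetilde{\mathcal{W}}_J$ in $\widetilde{\mathcal{W}}$. *)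

theory Defs
  imports "HOL-Analysis.Analysis" "HOL-Algebra.Bij" "HOL-Algebra.Generated_Groups"
    "HOL-Algebra.Group_Action"
    "HOL-Computational_Algebra.Computational_Algebra"
begin

section \<open>Root systems\<close>

text \<open>
  The space \<open>V\<close> is the Euclidean space \<open>'v\<close>, regarded only as a finite-dimensional real vector
  space (its inner product plays no role). In finite dimension every linear functional is bounded,
  so the dual space of \<open>V\<close> is the type \<open>'v \<Rightarrow>\<^sub>L real\<close>, and the natural pairing of
  \<open>\<alpha>\<close> with \<open>x\<close> is \<open>blinfun_apply x \<alpha>\<close>.
\<close>

type_synonym 'v dual = "'v \<Rightarrow>\<^sub>L real"

abbreviation pairing :: "'v::euclidean_space \<Rightarrow> 'v dual \<Rightarrow> real" where
  "pairing \<alpha> x \<equiv> blinfun_apply x \<alpha>"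

definition is_coroot :: "'v::euclidean_space set \<Rightarrow> 'v \<Rightarrow> 'v dual \<Rightarrow> bool" where
  "is_coroot \<Phi> \<alpha> f \<longleftrightarrow>
     pairing \<alpha> f = 2 \<and> (\<lambda>\<beta>. \<beta> - pairing \<beta> f *\<^sub>R \<alpha>) ` \<Phi> \<subseteq> \<Phi>"

text \<open>Uniqueness justifies the definite description used for \<open>coroot\<close>; the root system
  axioms are those of Bourbaki.\<close>

lemma is_coroot_unique:
  fixes \<Phi> :: "'v::euclidean_space set"
  assumes "finite \<Phi>" "span \<Phi> = UNIV" and f: "is_coroot \<Phi> \<alpha> f" and g: "is_coroot \<Phi> \<alpha> g"
  shows "f = g"
proof -
  define u where "u = (\<lambda>x. x + (pairing x g - pairing x f) *\<^sub>R \<alpha>)"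
  have f2: "pairing \<alpha> f = 2" and g2: "pairing \<alpha> g = 2"
    using f g by (auto simp: is_coroot_def)
  then have "\<alpha> \<noteq> 0" by auto
  have u\<Phi>: "u x \<in> \<Phi>" if "x \<in> \<Phi>" for x
  proof -
    have y: "x - pairing x g *\<^sub>R \<alpha> \<in> \<Phi>" (is "?y \<in> _")
      using g that by (auto simp: is_coroot_def)
    have "?y - pairing ?y f *\<^sub>R \<alpha> \<in> \<Phi>"
      using f y by (auto simp: is_coroot_def)
    moreover have "?y - pairing ?y f *\<^sub>R \<alpha> = u x"
      by (simp add: u_def f2 blinfun.diff_right blinfun.scaleR_right algebra_simps scaleR_2
          flip: scaleR_add_left)
    ultimately show ?thesis by simp
  qed
  have "pairing x f = pairing x g" if x: "x \<in> \<Phi>" for x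
  proof (rule ccontr)
    assume ne: "pairing x f \<noteq> pairing x g"
    define h where "h = (\<lambda>n::nat. x + (real n * (pairing x g - pairing x f)) *\<^sub>R \<alpha>)"
    have "h n \<in> \<Phi>" for n
    proof (induction n)
      case 0
      then show ?case using x by (simp add: h_def)
    next
      case (Suc n)
      have "pairing (h n) g - pairing (h n) f = pairing x g - pairing x f"
        by (simp add: h_def f2 g2 blinfun.add_right blinfun.scaleR_right)
      then have "u (h n) = h (Suc n)"
        by (simp add: u_def h_def distrib_right scaleR_add_left)
      then show ?case using u\<Phi>[OF Suc] by simp
    qed
    then have "finite (range h)"
      using \<open>finite \<Phi>\<close> by (meson finite_subset image_subsetI)
    moreover have "inj h"
      using ne \<open>\<alpha> \<noteq> 0\<close> by (auto simp: inj_def h_def)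
    ultimately show False
      using finite_imageD infinite_UNIV_nat by blast
  qed
  then have "blinfun_apply f x = blinfun_apply g x" if "x \<in> span \<Phi>" for x
    using linear_eq_on_span[of "blinfun_apply f" "blinfun_apply g" \<Phi>] that
    by (simp add: blinfun.bounded_linear_right bounded_linear.linear)
  with \<open>span \<Phi> = UNIV\<close> show ?thesis
    by (intro blinfun_eqI) auto
qed

definition coroot :: "'v::euclidean_space set \<Rightarrow> 'v \<Rightarrow> 'v dual" where
  "coroot \<Phi> \<alpha> = (THE f. is_coroot \<Phi> \<alpha> f)"

definition root_system :: "'v::euclidean_space set \<Rightarrow> bool" where
  "root_system \<Phi> \<longleftrightarrow>
     finite \<Phi> \<and> 0 \<notin> \<Phi> \<and> span \<Phi> = UNIV \<and>
     (\<forall>\<alpha>\<in>\<Phi>. \<exists>f. is_coroot \<Phi> \<alpha> f) \<and>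
     (\<forall>\<alpha>\<in>\<Phi>. \<forall>\<beta>\<in>\<Phi>. pairing \<beta> (coroot \<Phi> \<alpha>) \<in> \<int>)"

definition reduced_root_system :: "'v::euclidean_space set \<Rightarrow> bool" where
  "reduced_root_system \<Phi> \<longleftrightarrow>
     root_system \<Phi> \<and> (\<forall>\<alpha>\<in>\<Phi>. \<forall>c. c *\<^sub>R \<alpha> \<in> \<Phi> \<longrightarrow> c = 1 \<or> c = -1)"

text \<open>Nonemptiness is automatic: a Euclidean space type has positive dimension.\<close>

definition irreducible_root_system :: "'v::euclidean_space set \<Rightarrow> bool" where
  "irreducible_root_system \<Phi> \<longleftrightarrow>
     root_system \<Phi> \<and>
     \<not> (\<exists>\<Phi>\<^sub>1 \<Phi>\<^sub>2. \<Phi>\<^sub>1 \<noteq> {} \<and> \<Phi>\<^sub>2 \<noteq> {} \<and> \<Phi>\<^sub>1 \<inter> \<Phi>\<^sub>2 = {} \<and> \<Phi>\<^sub>1 \<union> \<Phi>\<^sub>2 = \<Phi> \<and>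
          (\<forall>\<alpha>\<in>\<Phi>\<^sub>1. \<forall>\<beta>\<in>\<Phi>\<^sub>2.
             pairing \<alpha> (coroot \<Phi> \<beta>) = 0 \<and> pairing \<beta> (coroot \<Phi> \<alpha>) = 0))"

definition root_base :: "'v::euclidean_space set \<Rightarrow> 'v set \<Rightarrow> bool" where
  "root_base \<Phi> \<Delta> \<longleftrightarrow>
     \<Delta> \<subseteq> \<Phi> \<and> independent \<Delta> \<and> span \<Delta> = UNIV \<and>
     (\<forall>\<beta>\<in>\<Phi>. \<exists>c::'v \<Rightarrow> nat. \<beta> = (\<Sum>\<alpha>\<in>\<Delta>. real (c \<alpha>) *\<^sub>R \<alpha>) \<or>
                            \<beta> = - (\<Sum>\<alpha>\<in>\<Delta>. real (c \<alpha>) *\<^sub>R \<alpha>))"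

definition highest_root :: "'v::euclidean_space set \<Rightarrow> 'v set \<Rightarrow> 'v \<Rightarrow> bool" where
  "highest_root \<Phi> \<Delta> \<theta> \<longleftrightarrow>
     \<theta> \<in> \<Phi> \<and> (\<forall>\<beta>\<in>\<Phi>. \<exists>c::'v \<Rightarrow> nat. \<theta> - \<beta> = (\<Sum>\<alpha>\<in>\<Delta>. real (c \<alpha>) *\<^sub>R \<alpha>))"


section \<open>The affine Weyl group\<close>

definition affine_reflection ::
    "'v::euclidean_space set \<Rightarrow> 'v \<Rightarrow> int \<Rightarrow> 'v dual \<Rightarrow> 'v dual" where
  "affine_reflection \<Phi> \<alpha> k x = x - (pairing \<alpha> x - of_int k) *\<^sub>R coroot \<Phi> \<alpha>"

lemma affine_reflection_in_BijGroup:
  assumes "root_system \<Phi>" "\<alpha> \<in> \<Phi>"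
  shows "affine_reflection \<Phi> \<alpha> k \<in> carrier (BijGroup UNIV)"
proof -
  have "is_coroot \<Phi> \<alpha> (coroot \<Phi> \<alpha>)"
    using assms is_coroot_unique unfolding root_system_def coroot_def by (metis theI)
  then have "pairing \<alpha> (coroot \<Phi> \<alpha>) = 2"
    by (simp add: is_coroot_def)
  then have "affine_reflection \<Phi> \<alpha> k (affine_reflection \<Phi> \<alpha> k x) = x" for x
    by (simp add: affine_reflection_def blinfun.diff_left blinfun.scaleR_left scaleR_left_diff_distrib
        mult.commute flip: scaleR_2)
  then have "bij (affine_reflection \<Phi> \<alpha> k)"
    by (metis involuntory_imp_bij)
  then show ?thesis
    by (simp add: BijGroup_def Bij_def)
qed

definition affine_weyl_group :: "'v::euclidean_space set \<Rightarrow> ('v dual \<Rightarrow> 'v dual) monoid" where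
  "affine_weyl_group \<Phi> =
     subgroup_generated (BijGroup UNIV) {affine_reflection \<Phi> \<alpha> k | \<alpha> k. \<alpha> \<in> \<Phi>}"

definition simple_reflections ::
    "'v::euclidean_space set \<Rightarrow> 'v set \<Rightarrow> ('v dual \<Rightarrow> 'v dual) set" where
  "simple_reflections \<Phi> \<Delta> = (\<lambda>\<alpha>. affine_reflection \<Phi> \<alpha> 0) ` \<Delta>"

definition affine_simple_reflections ::
    "'v::euclidean_space set \<Rightarrow> 'v set \<Rightarrow> 'v \<Rightarrow> ('v dual \<Rightarrow> 'v dual) set" where
  "affine_simple_reflections \<Phi> \<Delta> \<theta> =
     simple_reflections \<Phi> \<Delta> \<union> {affine_reflection \<Phi> \<theta> 1}"


section \<open>Lengths, double cosets and growth series\<close>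

text \<open>
  In this section \<open>G\<close> is a group and \<open>S\<close> a finite set of involutions generating it, so
  inverses of generators need not be allowed in words.
\<close>

definition cox_length :: "('a, 'b) monoid_scheme \<Rightarrow> 'a set \<Rightarrow> 'a \<Rightarrow> nat" where
  "cox_length G S w =
     (LEAST n. \<exists>ss. set ss \<subseteq> S \<and> length ss = n \<and> foldr (monoid.mult G) ss \<one>\<^bsub>G\<^esub> = w)"

definition min_double_coset_reps ::
    "('a, 'b) monoid_scheme \<Rightarrow> 'a set \<Rightarrow> 'a set \<Rightarrow> 'a set \<Rightarrow> 'a set" where
  "min_double_coset_reps G S J K =
     {w \<in> carrier G. (\<forall>s\<in>J. cox_length G S (s \<otimes>\<^bsub>G\<^esub> w) > cox_length G S w) \<and>
                     (\<forall>s\<in>K. cox_length G S (w \<otimes>\<^bsub>G\<^esub> s) > cox_length G S w)}"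

definition p_set ::
    "('a, 'b) monoid_scheme \<Rightarrow> 'a set \<Rightarrow> 'a set \<Rightarrow> 'a set \<Rightarrow> 'a set \<Rightarrow> 'a set" where
  "p_set G S Q J K =
     {x \<in> min_double_coset_reps G S J K.
        K \<inter> (\<lambda>s. inv\<^bsub>G\<^esub> x \<otimes>\<^bsub>G\<^esub> s \<otimes>\<^bsub>G\<^esub> x) ` J = Q}"

text \<open>As \<open>S\<close> is finite, there are only finitely many elements of each length.\<close>

definition growth_series :: "('a, 'b) monoid_scheme \<Rightarrow> 'a set \<Rightarrow> 'a set \<Rightarrow> int fps" where
  "growth_series G S X = Abs_fps (\<lambda>n. int (card {x \<in> X. cox_length G S x = n}))"

text \<open>
  An element of the field of rational functions over the rationals has a power series expansion
  (at 0) iff it can be written as \<open>p / q\<close> with nonzero constant coefficient of \<open>q\<close>; the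
  expansion is then the quotient of \<open>p\<close> by \<open>q\<close> in the ring of formal power series.
\<close>

definition rational_fps :: "int fps \<Rightarrow> bool" where
  "rational_fps F \<longleftrightarrow>
     (\<exists>p q :: rat poly. coeff q 0 \<noteq> 0 \<and>
        Abs_fps (\<lambda>n. of_int (fps_nth F n)) = fps_of_poly p / fps_of_poly q)"

end

theory Submission
  imports Defs
begin

text \<open>
  An element \<open>w\<close> of the affine Weyl group is an affine map of the dual space, hence given by its
  linear part and by the point \<open>w 0\<close>. Call the linear part together with the signs of all roots at
  \<open>w 0\<close> the \<^emph>\<open>sector\<close> of \<open>w\<close>; there are finitely many sectors. The theorem has two halves: the
  elements of one sector have a rational growth series, and each of the three sets is a union of
  sectors.

  The first half rests on a length formula. The length of \<open>w\<close> is the number of positive affine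
  functionals that become negative after composition with \<open>w\<close> (\<open>len_eq_card_inversions\<close>). Counting
  them for each gradient \<open>\<alpha>\<close> separately shows that the length is \<open>depth (w 0)\<close>, the sum of the
  numbers \<open>max 0 (- \<langle>\<alpha>, w 0\<rangle>)\<close> over all roots, plus a constant that depends only on the sector
  (\<open>len_eq_depth\<close>). Within a sector \<open>w 0\<close> runs through lattice points of one cell of the
  arrangement of root hyperplanes. After the choice of a base for which this cell is dominant, the
  cell is the open simplicial cone spanned by some of the fundamental coweights, and \<open>depth\<close> is
  linear on it. A multiple of each coweight is a translation in the group
  (\<open>transl_multiple_W\<close>); such translations along the edges of the cone preserve the sector and raise the
  length by a fixed positive \<open>d\<close>. Removing the image of such a translation multiplies the series by
  \<open>1 - t\<^sup>d\<close>, and once this is done for every edge only finitely many elements remain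
  (\<open>rational_growth_sector\<close>).

  For the second half, \<open>depth\<close> is invariant under the finite Weyl group, so multiplying by a finite
  simple reflection on either side changes the length by an amount that depends only on the sector.
  This settles the minimal double coset representatives. The other two sets involve conjugates of
  finite simple reflections that are required to lie in a subgroup fixing the origin. A conjugate of
  a reflection fixes the origin iff one root vanishes at a certain point, which is a condition on
  signs, and it then depends on the linear part alone (\<open>conj_fixing_zero\<close>).
\<close>

section \<open>Rational power series\<close>

text \<open>
  The denominator is a unit among the power series, so it can be cleared.
\<close>

lemma rational_fps_iff:
  "rational_fps F \<longleftrightarrow>
     (\<exists>p q :: rat poly. coeff q 0 \<noteq> 0 \<and>
        Abs_fps (\<lambda>n. of_int (fps_nth F n)) * fps_of_poly q = fps_of_poly p)"
proof -
  have "G = fps_of_poly p / fps_of_poly q \<longleftrightarrow> G * fps_of_poly q = fps_of_poly p"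
    if "coeff q 0 \<noteq> 0" for p q :: "rat poly" and G
  proof -
    have "fps_of_poly q \<noteq> 0" "fps_of_poly q dvd fps_of_poly p"
      using that by (auto simp: fps_is_unit_iff intro: unit_imp_dvd)
    then show ?thesis
      by (metis dvd_div_mult_self nonzero_mult_div_cancel_right)
  qed
  then show ?thesis
    unfolding rational_fps_def by blast
qed

definition int_to_rat_fps :: "int fps \<Rightarrow> rat fps" where
  "int_to_rat_fps F = Abs_fps (\<lambda>n. of_int (fps_nth F n))"

lemma int_to_rat_fps_add: "int_to_rat_fps (F + G) = int_to_rat_fps F + int_to_rat_fps G"
  by (simp add: int_to_rat_fps_def fps_eq_iff)

lemma int_to_rat_fps_mult: "int_to_rat_fps (F * G) = int_to_rat_fps F * int_to_rat_fps G"
  by (simp add: int_to_rat_fps_def fps_eq_iff fps_mult_nth)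

lemma rational_fps_add:
  assumes "rational_fps F" "rational_fps G"
  shows "rational_fps (F + G)"
proof -
  obtain p q p' q' where q: "coeff q 0 \<noteq> 0" "int_to_rat_fps F * fps_of_poly q = fps_of_poly p"
    and q': "coeff q' 0 \<noteq> 0" "int_to_rat_fps G * fps_of_poly q' = fps_of_poly p'"
    using assms unfolding rational_fps_iff int_to_rat_fps_def by blast
  have "int_to_rat_fps (F + G) * fps_of_poly (q * q')
      = (int_to_rat_fps F * fps_of_poly q) * fps_of_poly q'
        + (int_to_rat_fps G * fps_of_poly q') * fps_of_poly q"
    by (simp add: int_to_rat_fps_add fps_of_poly_mult algebra_simps)
  also have "\<dots> = fps_of_poly (p * q' + p' * q)"
    by (simp add: q q' fps_of_poly_mult fps_of_poly_add)
  finally show ?thesis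
    using q(1) q'(1) unfolding rational_fps_iff int_to_rat_fps_def
    by (intro exI[of _ "p * q' + p' * q"] exI[of _ "q * q'"]) (simp add: coeff_mult_0)
qed

lemma rational_fps_poly: "rational_fps (fps_of_poly p)"
proof -
  have "int_to_rat_fps (fps_of_poly p) = fps_of_poly (map_poly of_int p)"
    by (simp add: int_to_rat_fps_def fps_eq_iff coeff_map_poly)
  then show ?thesis
    unfolding rational_fps_iff int_to_rat_fps_def
    by (intro exI[of _ "map_poly of_int p"] exI[of _ 1]) simp
qed

lemma rational_fps_cancel_geometric:
  assumes "d > 0" and "rational_fps (F * (1 - fps_X ^ d))"
  shows "rational_fps F"
proof -
  obtain p q where q: "coeff q 0 \<noteq> 0"
      "int_to_rat_fps (F * (1 - fps_X ^ d)) * fps_of_poly q = fps_of_poly p"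
    using assms(2) unfolding rational_fps_iff int_to_rat_fps_def by blast
  have "int_to_rat_fps (1 - fps_X ^ d) = fps_of_poly (1 - monom 1 d)"
    by (auto simp: int_to_rat_fps_def fps_eq_iff fps_X_power_nth)
  then have "int_to_rat_fps F * fps_of_poly ((1 - monom 1 d) * q) = fps_of_poly p"
    using q(2) by (simp add: int_to_rat_fps_mult fps_of_poly_mult mult.assoc)
  moreover have "coeff ((1 - monom 1 d) * q) 0 \<noteq> 0"
    using q(1) \<open>d > 0\<close> by (simp add: coeff_mult_0)
  ultimately show ?thesis
    unfolding rational_fps_iff int_to_rat_fps_def by blast
qed

section \<open>Growth series of subsets\<close>

lemma growth_series_union:
  assumes "\<And>n. finite {x \<in> Y. cox_length G S x = n}" "X \<subseteq> Y" "X' \<subseteq> Y" "X \<inter> X' = {}"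
  shows "growth_series G S (X \<union> X') = growth_series G S X + growth_series G S X'"
proof -
  have "card {x \<in> X \<union> X'. cox_length G S x = n}
      = card {x \<in> X. cox_length G S x = n} + card {x \<in> X'. cox_length G S x = n}" for n
  proof -
    have "{x \<in> X \<union> X'. cox_length G S x = n}
        = {x \<in> X. cox_length G S x = n} \<union> {x \<in> X'. cox_length G S x = n}" by auto
    moreover have "finite {x \<in> X. cox_length G S x = n}" "finite {x \<in> X'. cox_length G S x = n}"
      using assms(2,3) by (auto intro: finite_subset[OF _ assms(1)[of n]])
    ultimately show ?thesis
      using assms(4) by (simp add: card_Un_disjoint disjoint_iff)
  qed
  then show ?thesis
    by (simp add: growth_series_def fps_eq_iff)
qed

lemma rational_growth_series_Union:
  assumes "finite I" and "\<And>n. finite {x \<in> Y. cox_length G S x = n}"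
    and "\<And>i. i \<in> I \<Longrightarrow> X i \<subseteq> Y" and "disjoint_family_on X I"
    and "\<And>i. i \<in> I \<Longrightarrow> rational_fps (growth_series G S (X i))"
  shows "rational_fps (growth_series G S (\<Union>i\<in>I. X i))"
  using assms(1,3-)
proof (induction I)
  case empty
  have "growth_series G S {} = fps_of_poly 0"
    by (simp add: growth_series_def fps_eq_iff)
  then show ?case
    using rational_fps_poly[of 0] by simp
next
  case (insert i I)
  have "X i \<inter> (\<Union>i\<in>I. X i) = {}"
    using insert.prems(2) insert.hyps(2) by (auto simp: disjoint_family_on_def)
  then have "growth_series G S (\<Union>i\<in>insert i I. X i)
      = growth_series G S (X i) + growth_series G S (\<Union>i\<in>I. X i)"
    using growth_series_union[OF assms(2), of "X i" "\<Union>i\<in>I. X i"] insert.prems(1) by auto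
  moreover have "rational_fps (growth_series G S (\<Union>i\<in>I. X i))"
    using insert by (auto simp: disjoint_family_on_def)
  ultimately show ?case
    using insert.prems(3) by (auto intro: rational_fps_add)
qed

lemma rational_growth_series_finite:
  assumes "finite X"
  shows "rational_fps (growth_series G S X)"
proof -
  have "growth_series G S X = fps_of_poly (\<Sum>x\<in>X. monom 1 (cox_length G S x))"
  proof (rule fps_ext)
    fix n
    have "(\<Sum>x\<in>X. if cox_length G S x = n then 1 else 0) = int (card {x \<in> X. cox_length G S x = n})"
      using assms by (simp add: sum.If_cases Int_def)
    then show "growth_series G S X $ n = fps_of_poly (\<Sum>x\<in>X. monom 1 (cox_length G S x)) $ n"
      by (simp add: growth_series_def coeff_sum)
  qed
  then show ?thesis
    by (simp add: rational_fps_poly)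
qed

text \<open>
  Since \<open>X\<close> is the disjoint union of \<open>\<tau> ` X\<close> and the rest, and \<open>\<tau> ` X\<close> contributes the
  series of \<open>X\<close> times \<open>t\<^sup>d\<close>, the series of the rest is \<open>1 - t\<^sup>d\<close> times that of \<open>X\<close>.
\<close>

lemma rational_growth_series_shift:
  assumes fin: "\<And>n. finite {x \<in> X. cox_length G S x = n}"
    and "inj_on \<tau> X" "\<tau> ` X \<subseteq> X" "d > 0"
    and shift: "\<And>x. x \<in> X \<Longrightarrow> cox_length G S (\<tau> x) = cox_length G S x + d"
    and rat: "rational_fps (growth_series G S (X - \<tau> ` X))"
  shows "rational_fps (growth_series G S X)"
proof -
  have "growth_series G S X = growth_series G S ((X - \<tau> ` X) \<union> \<tau> ` X)"
    using assms(3) by (simp add: Un_absorb2)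
  also have "\<dots> = growth_series G S (X - \<tau> ` X) + growth_series G S (\<tau> ` X)"
    using assms(3) by (intro growth_series_union[OF fin]) auto
  also have "growth_series G S (\<tau> ` X) = growth_series G S X * fps_X ^ d"
  proof (rule fps_ext)
    fix n
    have "card {x \<in> \<tau> ` X. cox_length G S x = n} = (if n < d then 0 else card {x \<in> X. cox_length G S x = n - d})"
    proof (cases "n < d")
      case True
      then have "{x \<in> \<tau> ` X. cox_length G S x = n} = {}"
        using shift by auto
      then show ?thesis using True by (simp only: card.empty if_True)
    next
      case False
      then have "{x \<in> \<tau> ` X. cox_length G S x = n} = \<tau> ` {x \<in> X. cox_length G S x = n - d}"
        using shift by auto
      moreover have "inj_on \<tau> {x \<in> X. cox_length G S x = n - d}"
        using assms(2) by (auto intro: inj_on_subset)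
      ultimately show ?thesis
        using False by (simp add: card_image)
    qed
    then show "growth_series G S (\<tau> ` X) $ n = (growth_series G S X * fps_X ^ d) $ n"
      by (simp add: growth_series_def fps_X_power_mult_right_nth)
  qed
  finally have "growth_series G S X * (1 - fps_X ^ d) = growth_series G S (X - \<tau> ` X)"
    by (simp add: algebra_simps)
  with rat have "rational_fps (growth_series G S X * (1 - fps_X ^ d))"
    by simp
  then show ?thesis
    using rational_fps_cancel_geometric[OF \<open>d > 0\<close>] by blast
qed

section \<open>Roots and coroots\<close>

lemma dual_separates:
  fixes u v :: "'v::euclidean_space"
  assumes "\<And>x :: 'v dual. pairing u x = pairing v x"
  shows "u = v"
proof (rule euclidean_eqI)
  fix b
  show "u \<bullet> b = v \<bullet> b"
    using assms[of "blinfun_inner_left b"] by simp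
qed

lemma pairing_linear:
  "pairing (u + v) x = pairing u x + pairing v x"
  "pairing (u - v) x = pairing u x - pairing v x"
  "pairing (- u) x = - pairing u x"
  "pairing (c *\<^sub>R u) x = c * pairing u x"
  "pairing (sum h A) x = (\<Sum>a\<in>A. pairing (h a) x)"
  "pairing u (x + y) = pairing u x + pairing u y"
  "pairing u (x - y) = pairing u x - pairing u y"
  "pairing u (- x) = - pairing u x"
  "pairing u (c *\<^sub>R x) = c * pairing u x"
  by (simp_all add: blinfun.bilinear_simps blinfun.sum_right)

lemma dual_eqI_spanning:
  fixes x y :: "'v::euclidean_space dual"
  assumes "span B = UNIV" and "\<And>b. b \<in> B \<Longrightarrow> pairing b x = pairing b y"
  shows "x = y"
proof (rule blinfun_eqI)
  fix v
  show "blinfun_apply x v = blinfun_apply y v"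
    using linear_eq_on_span[of "blinfun_apply x" "blinfun_apply y" B v] assms
    by (simp add: blinfun.bounded_linear_right bounded_linear.linear)
qed

locale roots =
  fixes \<Phi> :: "'v::euclidean_space set"
  assumes root_system: "root_system \<Phi>"
begin

abbreviation co :: "'v \<Rightarrow> 'v dual" where
  "co \<equiv> coroot \<Phi>"

lemma finite_roots: "finite \<Phi>" and zero_not_root: "0 \<notin> \<Phi>" and span_roots: "span \<Phi> = UNIV"
  using root_system by (auto simp: root_system_def)

lemma is_coroot_coroot: "\<alpha> \<in> \<Phi> \<Longrightarrow> is_coroot \<Phi> \<alpha> (co \<alpha>)"
  using root_system is_coroot_unique unfolding root_system_def coroot_def by (metis theI)

lemma coroot_eqI: "\<alpha> \<in> \<Phi> \<Longrightarrow> is_coroot \<Phi> \<alpha> f \<Longrightarrow> co \<alpha> = f"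
  using is_coroot_unique[OF finite_roots span_roots is_coroot_coroot] by blast

lemma pairing_coroot_self [simp]: "\<alpha> \<in> \<Phi> \<Longrightarrow> pairing \<alpha> (co \<alpha>) = 2"
  using is_coroot_coroot by (auto simp: is_coroot_def)

lemma pairing_coroot_Ints: "\<alpha> \<in> \<Phi> \<Longrightarrow> \<beta> \<in> \<Phi> \<Longrightarrow> pairing \<beta> (co \<alpha>) \<in> \<int>"
  using root_system by (auto simp: root_system_def)

definition root_refl :: "'v \<Rightarrow> 'v \<Rightarrow> 'v" where
  "root_refl \<alpha> \<beta> = \<beta> - pairing \<beta> (co \<alpha>) *\<^sub>R \<alpha>"

lemma pairing_root_refl: "pairing (root_refl \<alpha> \<beta>) x = pairing \<beta> x - pairing \<beta> (co \<alpha>) * pairing \<alpha> x"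
  by (simp add: root_refl_def pairing_linear)

lemma pairing_affine_reflection:
  "pairing \<beta> (affine_reflection \<Phi> \<alpha> k x) = pairing \<beta> x - (pairing \<alpha> x - of_int k) * pairing \<beta> (co \<alpha>)"
  by (simp add: affine_reflection_def pairing_linear)

lemma root_refl_in: "\<alpha> \<in> \<Phi> \<Longrightarrow> \<beta> \<in> \<Phi> \<Longrightarrow> root_refl \<alpha> \<beta> \<in> \<Phi>"
  using is_coroot_coroot by (auto simp: is_coroot_def root_refl_def)

lemma root_refl_self [simp]: "\<alpha> \<in> \<Phi> \<Longrightarrow> root_refl \<alpha> \<alpha> = - \<alpha>"
  by (simp add: root_refl_def scaleR_2)

lemma root_refl_involution [simp]: "\<alpha> \<in> \<Phi> \<Longrightarrow> root_refl \<alpha> (root_refl \<alpha> \<beta>) = \<beta>"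
  by (simp add: root_refl_def pairing_linear mult_2_right algebra_simps)

lemma root_refl_image: "\<alpha> \<in> \<Phi> \<Longrightarrow> root_refl \<alpha> ` \<Phi> = \<Phi>"
  using root_refl_in by (auto simp: image_iff) (metis root_refl_involution)

lemma linear_root_refl: "linear (root_refl \<alpha>)"
  by (rule linearI) (simp_all add: root_refl_def pairing_linear algebra_simps)

lemma minus_root: "\<alpha> \<in> \<Phi> \<Longrightarrow> - \<alpha> \<in> \<Phi>"
  using root_refl_in[of \<alpha> \<alpha>] by simp

text \<open>Uniqueness of coroots makes them equivariant under every linear automorphism of the root system.\<close>

lemma coroot_equivariant:
  assumes g: "linear g" "g ` \<Phi> = \<Phi>" and \<alpha>: "\<alpha> \<in> \<Phi>" and f: "\<And>\<gamma>. pairing \<gamma> f = pairing (g \<gamma>) (co (g \<alpha>))"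
  shows "f = co \<alpha>"
proof -
  have "inj_on g \<Phi>"
    using finite_roots g(2) by (metis eq_card_imp_inj_on)
  have surj: "surj g"
  proof -
    have "span (g ` \<Phi>) \<subseteq> range g"
      using g(1) by (metis linear_span_image span_UNIV span_roots subset_refl)
    then show ?thesis
      using g(2) span_roots by auto
  qed
  then have inj: "inj g"
    using g(1) linear_surjective_imp_injective by blast
  have g\<alpha>: "g \<alpha> \<in> \<Phi>" using g \<alpha> by auto
  have "is_coroot \<Phi> \<alpha> f"
    unfolding is_coroot_def
  proof (intro conjI subsetI)
    show "pairing \<alpha> f = 2"
      using g\<alpha> by (simp add: f)
  next
    fix \<delta>
    assume "\<delta> \<in> (\<lambda>\<beta>. \<beta> - pairing \<beta> f *\<^sub>R \<alpha>) ` \<Phi>"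
    then obtain \<gamma> where \<gamma>: "\<gamma> \<in> \<Phi>" "\<delta> = \<gamma> - pairing \<gamma> f *\<^sub>R \<alpha>" by blast
    have "g \<delta> = root_refl (g \<alpha>) (g \<gamma>)"
      by (simp add: \<gamma>(2) root_refl_def f linear_diff[OF g(1)] linear_scale[OF g(1)])
    also have "\<dots> \<in> g ` \<Phi>"
      using root_refl_in[OF g\<alpha>, of "g \<gamma>"] \<gamma>(1) g(2) by auto
    finally show "\<delta> \<in> \<Phi>"
      using inj by (simp add: inj_image_mem_iff)
  qed
  then show ?thesis
    using coroot_eqI \<alpha> by blast
qed

lemma coroot_minus: "\<alpha> \<in> \<Phi> \<Longrightarrow> co (- \<alpha>) = - co \<alpha>"
proof -
  assume \<alpha>: "\<alpha> \<in> \<Phi>"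
  have "uminus ` \<Phi> = \<Phi>"
    using minus_root by (metis image_subsetI minus_minus subset_antisym subsetI rev_image_eqI)
  then have "- co \<alpha> = co (- \<alpha>)"
    using \<alpha> minus_root[OF \<alpha>] by (intro coroot_equivariant[of uminus]) (auto simp: pairing_linear linear_uminus)
  then show ?thesis by simp
qed

text \<open>
  A canonical bilinear form on the dual space. It is invariant under every reflection because
  reflections permute the roots, and positive definite because the roots span.
\<close>

definition form :: "'v dual \<Rightarrow> 'v dual \<Rightarrow> real" where
  "form f g = (\<Sum>\<alpha>\<in>\<Phi>. pairing \<alpha> f * pairing \<alpha> g)"

text \<open>
  Compare the form at \<open>f\<close> and the coroot of \<open>\<beta>\<close> before and after the reflection in \<open>\<beta>\<close>, which
  negates that coroot.
\<close>

lemma form_coroot: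
  assumes "\<beta> \<in> \<Phi>"
  shows "2 * form f (co \<beta>) = form (co \<beta>) (co \<beta>) * pairing \<beta> f"
proof -
  have "form f (co \<beta>) = (\<Sum>\<alpha>\<in>\<Phi>. pairing (root_refl \<beta> \<alpha>) f * pairing (root_refl \<beta> \<alpha>) (co \<beta>))"
    unfolding form_def
    by (rule sum.reindex_bij_witness[of _ "root_refl \<beta>" "root_refl \<beta>"])
       (use assms in \<open>auto simp: root_refl_in\<close>)
  also have "\<dots> = (\<Sum>\<alpha>\<in>\<Phi>. pairing \<beta> f * (pairing \<alpha> (co \<beta>) * pairing \<alpha> (co \<beta>))
                      - pairing \<alpha> f * pairing \<alpha> (co \<beta>))"
    using assms by (intro sum.cong) (simp_all add: root_refl_def pairing_linear algebra_simps)
  also have "\<dots> = pairing \<beta> f * form (co \<beta>) (co \<beta>) - form f (co \<beta>)"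
    by (simp add: form_def sum_subtractf sum_distrib_left)
  finally show ?thesis by simp
qed

lemma form_coroot_pos:
  assumes "\<beta> \<in> \<Phi>"
  shows "form (co \<beta>) (co \<beta>) > 0"
proof -
  have "0 < pairing \<beta> (co \<beta>) * pairing \<beta> (co \<beta>)"
    using assms by simp
  also have "\<dots> \<le> form (co \<beta>) (co \<beta>)"
    unfolding form_def using assms finite_roots
    by (intro member_le_sum) auto
  finally show ?thesis .
qed

text \<open>Both numbers are positive multiples of the form between the two coroots.\<close>

lemma pairing_coroot_pos_sym:
  assumes "\<alpha> \<in> \<Phi>" "\<beta> \<in> \<Phi>" "pairing \<alpha> (co \<beta>) > 0"
  shows "pairing \<beta> (co \<alpha>) > 0"
proof -
  have "form (co \<beta>) (co \<alpha>) = form (co \<alpha>) (co \<beta>)"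
    by (simp add: form_def mult.commute)
  then have "form (co \<alpha>) (co \<alpha>) * pairing \<alpha> (co \<beta>) = form (co \<beta>) (co \<beta>) * pairing \<beta> (co \<alpha>)"
    using form_coroot[OF assms(1), of "co \<beta>"] form_coroot[OF assms(2), of "co \<alpha>"] by simp
  then show ?thesis
    using form_coroot_pos assms by (metis mult_pos_pos zero_less_mult_pos)
qed

text \<open>
  The map \<open>f \<mapsto> \<Sum>\<^sub>\<beta> f(\<beta>) \<beta>\<^sup>\<or>\<close> has trivial kernel: its value at \<open>f\<close>, paired with \<open>f\<close> by the
  invariant form, is a sum of positive multiples of the squares \<open>f(\<beta>)\<^sup>2\<close>. The proof transports it to
  \<open>V\<close>, where an injective endomorphism is surjective.
\<close>

lemma coroots_span:
  "\<exists>c. x = (\<Sum>\<beta>\<in>\<Phi>. c \<beta> *\<^sub>R co \<beta>)"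
proof -
  define riesz :: "'v dual \<Rightarrow> 'v" where "riesz f = (\<Sum>b\<in>Basis. pairing b f *\<^sub>R b)" for f
  have riesz: "f = blinfun_inner_left (riesz f)" for f
    by (rule blinfun_euclidean_eqI) (simp add: riesz_def inner_sum_right inner_Basis if_distrib cong: if_cong)
  define T :: "'v \<Rightarrow> 'v dual" where "T v = (\<Sum>\<beta>\<in>\<Phi>. (\<beta> \<bullet> v) *\<^sub>R co \<beta>)" for v
  have "T (u + v) = T u + T v" "T (c *\<^sub>R v) = c *\<^sub>R T v" for u v c
    by (simp_all add: T_def inner_add_right scaleR_add_left sum.distrib scaleR_sum_right)
  then have lin: "linear (\<lambda>v. riesz (T v))"
    by (intro linearI)
       (simp_all add: riesz_def pairing_linear scaleR_add_left sum.distrib scaleR_sum_right)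
  have "v = 0" if "riesz (T v) = 0" for v
  proof -
    define f :: "'v dual" where "f = blinfun_inner_left v"
    have "T v = 0"
      using riesz[of "T v"] that by (metis blinfun_inner_left.rep_eq blinfun_eqI inner_zero_right zero_blinfun.rep_eq)
    then have "0 = 2 * form f (T v)"
      by (simp add: form_def)
    also have "\<dots> = (\<Sum>\<beta>\<in>\<Phi>. pairing \<beta> f * (2 * form f (co \<beta>)))"
    proof -
      have "form f (T v) = (\<Sum>\<alpha>\<in>\<Phi>. \<Sum>\<beta>\<in>\<Phi>. pairing \<beta> f * (pairing \<alpha> f * pairing \<alpha> (co \<beta>)))"
        by (simp add: form_def T_def f_def blinfun.sum_left blinfun.scaleR_left sum_distrib_left
            mult.left_commute)
      also have "\<dots> = (\<Sum>\<beta>\<in>\<Phi>. pairing \<beta> f * form f (co \<beta>))"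
        unfolding form_def sum_distrib_left by (rule sum.swap)
      finally show ?thesis
        by (simp add: sum_distrib_left mult.left_commute)
    qed
    also have "\<dots> = (\<Sum>\<beta>\<in>\<Phi>. form (co \<beta>) (co \<beta>) * (pairing \<beta> f)\<^sup>2)"
      by (intro sum.cong) (simp_all add: form_coroot power2_eq_square)
    finally have "(\<Sum>\<beta>\<in>\<Phi>. form (co \<beta>) (co \<beta>) * (pairing \<beta> f)\<^sup>2) = 0" by simp
    moreover have "0 \<le> form (co \<beta>) (co \<beta>) * (pairing \<beta> f)\<^sup>2" if "\<beta> \<in> \<Phi>" for \<beta>
      using form_coroot_pos[OF that] by simp
    ultimately have "\<forall>\<beta>\<in>\<Phi>. form (co \<beta>) (co \<beta>) * (pairing \<beta> f)\<^sup>2 = 0"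
      using finite_roots by (simp add: sum_nonneg_eq_0_iff)
    then have "pairing \<beta> f = pairing \<beta> 0" if "\<beta> \<in> \<Phi>" for \<beta>
      using form_coroot_pos[OF that] that by auto
    then have "f = 0"
      using dual_eqI_spanning[OF span_roots] by blast
    then have "v \<bullet> v = 0"
      unfolding f_def by (metis blinfun_inner_left.rep_eq zero_blinfun.rep_eq)
    then show "v = 0" by simp
  qed
  then have "inj (\<lambda>v. riesz (T v))"
    using lin linear_injective_0 by blast
  then have "surj (\<lambda>v. riesz (T v))"
    using lin linear_injective_imp_surjective by blast
  then obtain v where "riesz x = riesz (T v)"
    by (metis surjD)
  then have "x = T v"
    using riesz by metis
  then show ?thesis
    unfolding T_def by (intro exI[of _ "\<lambda>\<beta>. \<beta> \<bullet> v"])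
qed

section \<open>The affine Weyl group acting on affine functionals\<close>

definition W :: "('v dual \<Rightarrow> 'v dual) set" where
  "W = carrier (affine_weyl_group \<Phi>)"

lemma refl_involution:
  assumes "\<alpha> \<in> \<Phi>"
  shows "affine_reflection \<Phi> \<alpha> k (affine_reflection \<Phi> \<alpha> k x) = x"
proof (rule dual_eqI_spanning[OF span_roots])
  fix \<beta>
  show "pairing \<beta> (affine_reflection \<Phi> \<alpha> k (affine_reflection \<Phi> \<alpha> k x)) = pairing \<beta> x"
    using assms by (simp add: pairing_affine_reflection left_diff_distrib)
qed

lemma W_is_group: "group (affine_weyl_group \<Phi>)"
  unfolding affine_weyl_group_def by (rule group.group_subgroup_generated[OF group_BijGroup])

lemma W_bij: "w \<in> W \<Longrightarrow> bij w"
proof -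
  have "carrier (affine_weyl_group \<Phi>) \<subseteq> carrier (BijGroup UNIV)"
    unfolding affine_weyl_group_def
    by (rule group.carrier_subgroup_generated_subset[OF group_BijGroup])
  then show "w \<in> W \<Longrightarrow> bij w"
    by (auto simp: W_def BijGroup_def Bij_def)
qed

lemma one_W: "\<one>\<^bsub>affine_weyl_group \<Phi>\<^esub> = id"
  by (simp add: affine_weyl_group_def BijGroup_def id_def restrict_def)

lemma mult_W: "u \<in> W \<Longrightarrow> w \<in> W \<Longrightarrow> u \<otimes>\<^bsub>affine_weyl_group \<Phi>\<^esub> w = u \<circ> w"
  using W_bij[of u] W_bij[of w]
  by (simp add: affine_weyl_group_def BijGroup_def Bij_def compose_def comp_def restrict_def)

lemma W_comp: "u \<in> W \<Longrightarrow> w \<in> W \<Longrightarrow> u \<circ> w \<in> W"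
  using monoid.m_closed[OF group.is_monoid[OF W_is_group], of u w] mult_W[of u w]
  by (simp add: W_def)

lemma W_id: "id \<in> W"
  using monoid.one_closed[OF group.is_monoid[OF W_is_group]] one_W by (simp add: W_def)

lemma W_refl: "\<alpha> \<in> \<Phi> \<Longrightarrow> affine_reflection \<Phi> \<alpha> k \<in> W"
  unfolding W_def affine_weyl_group_def carrier_subgroup_generated
  using affine_reflection_in_BijGroup[OF root_system, of \<alpha> k] by (intro generate.incl) blast

lemma inv_W:
  assumes "w \<in> W"
  shows "inv\<^bsub>affine_weyl_group \<Phi>\<^esub> w \<in> W" "inv\<^bsub>affine_weyl_group \<Phi>\<^esub> w \<circ> w = id"
    "w \<circ> inv\<^bsub>affine_weyl_group \<Phi>\<^esub> w = id"
proof -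
  show iw: "inv\<^bsub>affine_weyl_group \<Phi>\<^esub> w \<in> W"
    using assms group.inv_closed[OF W_is_group] by (simp add: W_def)
  show "inv\<^bsub>affine_weyl_group \<Phi>\<^esub> w \<circ> w = id" "w \<circ> inv\<^bsub>affine_weyl_group \<Phi>\<^esub> w = id"
    using assms iw group.l_inv[OF W_is_group, of w] group.r_inv[OF W_is_group, of w] mult_W one_W
    by (metis W_def)+
qed

lemma W_induct [consumes 1, case_names id refl comp]:
  assumes "w \<in> W" and "P id" and "\<And>\<alpha> k. \<alpha> \<in> \<Phi> \<Longrightarrow> P (affine_reflection \<Phi> \<alpha> k)"
    and comp: "\<And>u w. u \<in> W \<Longrightarrow> w \<in> W \<Longrightarrow> P u \<Longrightarrow> P w \<Longrightarrow> P (u \<circ> w)"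
  shows "P w"
proof -
  let ?R = "carrier (BijGroup UNIV) \<inter> {affine_reflection \<Phi> \<alpha> k |\<alpha> k. \<alpha> \<in> \<Phi>}"
  have W: "W = generate (BijGroup UNIV) ?R"
    by (simp add: W_def affine_weyl_group_def carrier_subgroup_generated)
  have "u \<in> W \<and> P u" if "u \<in> generate (BijGroup UNIV) ?R" for u
    using that
  proof induction
    case one
    have "\<one>\<^bsub>BijGroup (UNIV :: 'v dual set)\<^esub> = id" by (simp add: BijGroup_def id_def restrict_def)
    then show ?case using W_id assms(2) by metis
  next
    case (incl h)
    then show ?case using W_refl assms(3) by auto
  next
    case (inv h)
    then obtain \<alpha> k where h: "h = affine_reflection \<Phi> \<alpha> k" "\<alpha> \<in> \<Phi>" "h \<in> Bij UNIV"
      by (auto simp: BijGroup_def)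
    have "inv\<^bsub>BijGroup UNIV\<^esub> h = inv_into UNIV h"
      unfolding inv_BijGroup[OF h(3)] by (simp add: restrict_def)
    also have "\<dots> = h"
      by (rule inv_equality) (simp_all add: h(1) refl_involution[OF h(2)])
    finally have "inv\<^bsub>BijGroup UNIV\<^esub> h = affine_reflection \<Phi> \<alpha> k"
      using h(1) by simp
    then show ?case
      using W_refl[OF h(2)] assms(3)[OF h(2)] by metis
  next
    case (eng h1 h2)
    have "h1 \<otimes>\<^bsub>BijGroup UNIV\<^esub> h2 = h1 \<circ> h2"
      using mult_W[of h1 h2] eng by (simp add: affine_weyl_group_def)
    then show ?case
      using eng comp[of h1 h2] W_comp[of h1 h2] by metis
  qed
  then show ?thesis
    using assms(1) W by blast
qed

text \<open>
  The adjoint of the linear part of an affine map; it acts on \<open>V\<close>, contravariantly in \<open>w\<close>.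
\<close>

definition grad :: "('v dual \<Rightarrow> 'v dual) \<Rightarrow> 'v \<Rightarrow> 'v" where
  "grad w = (THE g. \<forall>\<alpha> x. pairing \<alpha> (w x) = pairing (g \<alpha>) x + pairing \<alpha> (w 0))"

lemma grad_eqI:
  assumes "\<And>\<alpha> x. pairing \<alpha> (w x) = pairing (g \<alpha>) x + pairing \<alpha> (w 0)"
  shows "grad w = g"
  unfolding grad_def
proof (rule the_equality)
  show "\<forall>\<alpha> x. pairing \<alpha> (w x) = pairing (g \<alpha>) x + pairing \<alpha> (w 0)"
    using assms by blast
next
  fix h
  assume h: "\<forall>\<alpha> x. pairing \<alpha> (w x) = pairing (h \<alpha>) x + pairing \<alpha> (w 0)"
  have "h \<alpha> = g \<alpha>" for \<alpha>
    by (rule dual_separates) (metis h assms add_right_cancel)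
  then show "h = g" by blast
qed

lemma grad_refl:
  assumes "\<alpha> \<in> \<Phi>"
  shows "grad (affine_reflection \<Phi> \<alpha> k) = root_refl \<alpha>"
  by (rule grad_eqI) (simp add: pairing_affine_reflection pairing_root_refl left_diff_distrib)

lemma grad_id [simp]: "grad id = id"
  by (rule grad_eqI) simp

lemma
  assumes "w \<in> W"
  shows pairing_W: "pairing \<alpha> (w x) = pairing (grad w \<alpha>) x + pairing \<alpha> (w 0)"
    and linear_grad: "linear (grad w)"
    and grad_image: "grad w ` \<Phi> = \<Phi>"
    and pairing_W_Ints: "\<alpha> \<in> \<Phi> \<Longrightarrow> pairing \<alpha> (w 0) \<in> \<int>"
proof -
  have "\<exists>g. linear g \<and> g ` \<Phi> = \<Phi> \<and> (\<forall>\<alpha> x. pairing \<alpha> (w x) = pairing (g \<alpha>) x + pairing \<alpha> (w 0))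
     \<and> (\<forall>\<alpha>\<in>\<Phi>. pairing \<alpha> (w 0) \<in> \<int>)"
    using assms
  proof (induction rule: W_induct)
    case id
    have "linear (\<lambda>v :: 'v. v)" by (rule linearI) simp_all
    then show ?case by (intro exI[of _ "\<lambda>v. v"]) simp
  next
    case (refl \<alpha> k)
    have "pairing \<beta> (affine_reflection \<Phi> \<alpha> k x)
        = pairing (root_refl \<alpha> \<beta>) x + pairing \<beta> (affine_reflection \<Phi> \<alpha> k 0)" for \<beta> x
      by (simp add: pairing_affine_reflection pairing_root_refl left_diff_distrib)
    moreover have "pairing \<beta> (affine_reflection \<Phi> \<alpha> k 0) \<in> \<int>" if "\<beta> \<in> \<Phi>" for \<beta>
      using pairing_coroot_Ints[OF refl that] by (simp add: pairing_affine_reflection)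
    ultimately show ?case
      using linear_root_refl root_refl_image[OF refl] by blast
  next
    case (comp u w)
    then obtain g h where g: "linear g" "g ` \<Phi> = \<Phi>"
        "\<And>\<alpha> x. pairing \<alpha> (u x) = pairing (g \<alpha>) x + pairing \<alpha> (u 0)" "\<And>\<alpha>. \<alpha> \<in> \<Phi> \<Longrightarrow> pairing \<alpha> (u 0) \<in> \<int>"
      and h: "linear h" "h ` \<Phi> = \<Phi>"
        "\<And>\<alpha> x. pairing \<alpha> (w x) = pairing (h \<alpha>) x + pairing \<alpha> (w 0)" "\<And>\<alpha>. \<alpha> \<in> \<Phi> \<Longrightarrow> pairing \<alpha> (w 0) \<in> \<int>"
      by metis
    have "pairing \<alpha> (u (w x)) = pairing (h (g \<alpha>)) x + pairing \<alpha> (u (w 0))" for \<alpha> x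
      using g(3)[of "w x" \<alpha>] g(3)[of "w 0" \<alpha>] h(3)[of x "g \<alpha>"] by simp
    moreover have "pairing \<alpha> (u (w 0)) \<in> \<int>" if "\<alpha> \<in> \<Phi>" for \<alpha>
      using g(3)[of "w 0" \<alpha>] g(4)[OF that] h(4)[of "g \<alpha>"] g(2) that by force
    moreover have "(h \<circ> g) ` \<Phi> = \<Phi>"
      by (metis g(2) h(2) image_comp)
    ultimately show ?case
      unfolding comp_apply using linear_compose[OF g(1) h(1)] unfolding comp_def by blast
  qed
  then obtain g where g: "linear g" "g ` \<Phi> = \<Phi>"
      "\<And>\<alpha> x. pairing \<alpha> (w x) = pairing (g \<alpha>) x + pairing \<alpha> (w 0)" "\<forall>\<alpha>\<in>\<Phi>. pairing \<alpha> (w 0) \<in> \<int>"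
    by blast
  have gw: "grad w = g"
    using g(3) by (rule grad_eqI)
  show "pairing \<alpha> (w x) = pairing (grad w \<alpha>) x + pairing \<alpha> (w 0)"
    "linear (grad w)" "grad w ` \<Phi> = \<Phi>" "\<alpha> \<in> \<Phi> \<Longrightarrow> pairing \<alpha> (w 0) \<in> \<int>"
    unfolding gw using g by blast+
qed

lemma grad_comp:
  assumes "u \<in> W" "w \<in> W"
  shows "grad (u \<circ> w) = grad w \<circ> grad u"
proof (rule grad_eqI)
  fix \<alpha> x
  show "pairing \<alpha> ((u \<circ> w) x) = pairing ((grad w \<circ> grad u) \<alpha>) x + pairing \<alpha> ((u \<circ> w) 0)"
    using pairing_W[OF assms(1), of "w x" \<alpha>] pairing_W[OF assms(1), of "w 0" \<alpha>]
      pairing_W[OF assms(2), of x "grad u \<alpha>"] by simp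
qed

lemma grad_in: "w \<in> W \<Longrightarrow> \<alpha> \<in> \<Phi> \<Longrightarrow> grad w \<alpha> \<in> \<Phi>"
  using grad_image by blast

lemma grad_minus: "w \<in> W \<Longrightarrow> grad w (- \<alpha>) = - grad w \<alpha>"
  using linear_grad linear_neg by blast

lemma W_eqI:
  assumes "u \<in> W" "w \<in> W" "grad u = grad w" "u 0 = w 0"
  shows "u = w"
proof
  fix x
  show "u x = w x"
    by (rule dual_eqI_spanning[OF span_roots]) (metis assms pairing_W)
qed

text \<open>
  The pair \<open>(\<alpha>, k)\<close> stands for the affine functional \<open>x \<mapsto> \<langle>\<alpha>, x\<rangle> + k\<close>, so that
  \<open>aff_act w\<close> is composition with \<open>w\<close> and \<open>aff_refl\<close> is the reflection
  in the zero set of the functional.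
\<close>

definition aff_act :: "('v dual \<Rightarrow> 'v dual) \<Rightarrow> 'v \<times> int \<Rightarrow> 'v \<times> int" where
  "aff_act w a = (grad w (fst a), snd a + \<lfloor>pairing (fst a) (w 0)\<rfloor>)"

definition aff_refl :: "'v \<times> int \<Rightarrow> 'v dual \<Rightarrow> 'v dual" where
  "aff_refl a = affine_reflection \<Phi> (fst a) (- snd a)"

abbreviation neg :: "'v \<times> int \<Rightarrow> 'v \<times> int" where
  "neg a \<equiv> (- fst a, - snd a)"

lemma aff_refl_W: "fst a \<in> \<Phi> \<Longrightarrow> aff_refl a \<in> W"
  by (simp add: aff_refl_def W_refl)

lemma aff_refl_involution: "fst a \<in> \<Phi> \<Longrightarrow> aff_refl a \<circ> aff_refl a = id"
  using refl_involution by (auto simp: aff_refl_def)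

lemma aff_refl_neg: "fst a \<in> \<Phi> \<Longrightarrow> aff_refl (neg a) = aff_refl a"
  by (auto simp: aff_refl_def affine_reflection_def coroot_minus pairing_linear fun_eq_iff algebra_simps)

lemma floor_pairing_W: "w \<in> W \<Longrightarrow> \<alpha> \<in> \<Phi> \<Longrightarrow> real_of_int \<lfloor>pairing \<alpha> (w 0)\<rfloor> = pairing \<alpha> (w 0)"
  using pairing_W_Ints by (metis Ints_cases floor_of_int)

lemma aff_act_refl:
  assumes "fst a \<in> \<Phi>" "fst b \<in> \<Phi>"
  obtains n where "pairing (fst b) (co (fst a)) = real_of_int n"
    "aff_act (aff_refl a) b = (fst b - of_int n *\<^sub>R fst a, snd b - n * snd a)"
proof -
  obtain n where n: "pairing (fst b) (co (fst a)) = of_int n"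
    using pairing_coroot_Ints[OF assms] by (auto elim: Ints_cases)
  have "pairing (fst b) (aff_refl a 0) = of_int (- n * snd a)"
    by (simp add: aff_refl_def pairing_affine_reflection n)
  then have "\<lfloor>pairing (fst b) (aff_refl a 0)\<rfloor> = - n * snd a"
    by (metis floor_of_int)
  moreover have "grad (aff_refl a) (fst b) = fst b - of_int n *\<^sub>R fst a"
    using assms n by (simp add: aff_refl_def grad_refl root_refl_def)
  ultimately show ?thesis
    using that[of n] n by (simp add: aff_act_def)
qed

lemma aff_act_refl_self: "fst a \<in> \<Phi> \<Longrightarrow> aff_act (aff_refl a) a = neg a"
  using aff_act_refl[of a a] by (auto simp: scaleR_2)

lemma aff_act_comp:
  assumes "u \<in> W" "w \<in> W" "fst a \<in> \<Phi>"
  shows "aff_act (u \<circ> w) a = aff_act w (aff_act u a)"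
proof -
  have "pairing (fst a) (u (w 0)) = of_int (\<lfloor>pairing (grad u (fst a)) (w 0)\<rfloor> + \<lfloor>pairing (fst a) (u 0)\<rfloor>)"
    unfolding of_int_add pairing_W[OF assms(1), of "w 0"]
    using floor_pairing_W[OF assms(1,3)] floor_pairing_W[OF assms(2) grad_in[OF assms(1,3)]] by argo
  then have "\<lfloor>pairing (fst a) (u (w 0))\<rfloor> = \<lfloor>pairing (grad u (fst a)) (w 0)\<rfloor> + \<lfloor>pairing (fst a) (u 0)\<rfloor>"
    by (metis floor_of_int)
  then show ?thesis
    using assms by (simp add: aff_act_def grad_comp)
qed

lemma aff_act_id [simp]: "aff_act id a = a"
  by (simp add: aff_act_def)

lemma aff_act_root: "w \<in> W \<Longrightarrow> fst a \<in> \<Phi> \<Longrightarrow> fst (aff_act w a) \<in> \<Phi>"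
  by (simp add: aff_act_def grad_in)

lemma aff_act_neg: 
  assumes "w \<in> W" "fst a \<in> \<Phi>"
  shows "aff_act w (neg a) = neg (aff_act w a)"
proof -
  have "real_of_int \<lfloor>- pairing (fst a) (w 0)\<rfloor> = - real_of_int \<lfloor>pairing (fst a) (w 0)\<rfloor>"
    using floor_pairing_W[OF assms] floor_pairing_W[OF assms(1) minus_root[OF assms(2)]]
    unfolding pairing_linear by argo
  then have "\<lfloor>- pairing (fst a) (w 0)\<rfloor> = - \<lfloor>pairing (fst a) (w 0)\<rfloor>"
    by linarith
  then show ?thesis
    using assms by (simp add: aff_act_def grad_minus pairing_linear)
qed

lemma aff_act_refl_involution:
  assumes "fst a \<in> \<Phi>" "fst b \<in> \<Phi>"
  shows "aff_act (aff_refl a) (aff_act (aff_refl a) b) = b"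
  using aff_act_comp[OF aff_refl_W[OF assms(1)] aff_refl_W[OF assms(1)] assms(2)]
    aff_refl_involution[OF assms(1)] by simp

text \<open>
  Composition with \<open>w\<close> moves the zero set of \<open>a\<close> to that of \<open>aff_act w a\<close>, and the linear part of \<open>w\<close>
  matches the two coroots by equivariance.
\<close>

lemma aff_refl_conj:
  assumes "w \<in> W" "fst a \<in> \<Phi>"
  shows "aff_refl a \<circ> w = w \<circ> aff_refl (aff_act w a)"
proof
  fix x
  let ?\<alpha> = "fst a" let ?\<beta> = "grad w ?\<alpha>"
  note floor = floor_pairing_W[OF assms]
  define c where "c = pairing ?\<beta> x + pairing ?\<alpha> (w 0) + of_int (snd a)"
  have \<beta>: "?\<beta> \<in> \<Phi>" using assms grad_in by blast
  have co: "pairing (grad w \<gamma>) (co ?\<beta>) = pairing \<gamma> (co ?\<alpha>)" for \<gamma>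
  proof -
    define f where "f = w (co ?\<beta>) - w 0"
    have f: "pairing \<gamma> f = pairing (grad w \<gamma>) (co ?\<beta>)" for \<gamma>
      by (simp add: f_def pairing_linear pairing_W[OF assms(1), of "co ?\<beta>"])
    then have "f = co ?\<alpha>"
      using coroot_equivariant linear_grad grad_image assms by blast
    then show ?thesis using f by simp
  qed
  show "(aff_refl a \<circ> w) x = (w \<circ> aff_refl (aff_act w a)) x"
  proof (rule dual_eqI_spanning[OF span_roots])
    fix \<gamma>
    have r: "aff_refl (aff_act w a) x = x - c *\<^sub>R co ?\<beta>"
      by (simp add: aff_refl_def affine_reflection_def aff_act_def c_def floor add.assoc)
    have "pairing \<gamma> ((aff_refl a \<circ> w) x) = pairing \<gamma> (w x) - c * pairing \<gamma> (co ?\<alpha>)"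
      using pairing_W[OF assms(1), of x ?\<alpha>] by (simp add: aff_refl_def pairing_affine_reflection c_def)
    also have "\<dots> = pairing (grad w \<gamma>) (x - c *\<^sub>R co ?\<beta>) + pairing \<gamma> (w 0)"
      by (simp add: pairing_W[OF assms(1), of x] pairing_linear co)
    also have "\<dots> = pairing \<gamma> (w (x - c *\<^sub>R co ?\<beta>))"
      by (simp add: pairing_W[OF assms(1), of "x - c *\<^sub>R co ?\<beta>"])
    finally show "pairing \<gamma> ((aff_refl a \<circ> w) x) = pairing \<gamma> ((w \<circ> aff_refl (aff_act w a)) x)"
      by (simp add: r)
  qed
qed

definition transl :: "'v dual \<Rightarrow> 'v dual \<Rightarrow> 'v dual" where
  "transl t x = t + x"

lemma transl_coroot_W:
  assumes "\<alpha> \<in> \<Phi>"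
  shows "transl (co \<alpha>) \<in> W"
proof -
  have "affine_reflection \<Phi> \<alpha> 1 \<circ> affine_reflection \<Phi> \<alpha> 0 = transl (co \<alpha>)"
  proof (intro ext dual_eqI_spanning[OF span_roots])
    fix x \<beta>
    show "pairing \<beta> ((affine_reflection \<Phi> \<alpha> 1 \<circ> affine_reflection \<Phi> \<alpha> 0) x) = pairing \<beta> (transl (co \<alpha>) x)"
      using assms by (simp add: pairing_affine_reflection transl_def pairing_linear left_diff_distrib)
  qed
  then show ?thesis
    using W_comp[OF W_refl W_refl] assms by metis
qed

lemma transl_minus_W: "transl t \<in> W \<Longrightarrow> transl (- t) \<in> W"
proof -
  assume t: "transl t \<in> W"
  let ?i = "inv\<^bsub>affine_weyl_group \<Phi>\<^esub> (transl t)"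
  have "?i x = transl (- t) x" for x
  proof -
    have "?i (transl t (x - t)) = x - t"
      using inv_W(2)[OF t] by (metis comp_apply id_apply)
    then show ?thesis by (simp add: transl_def)
  qed
  then show ?thesis
    using inv_W(1)[OF t] by (metis ext)
qed

lemma transl_add_W: "transl s \<in> W \<Longrightarrow> transl t \<in> W \<Longrightarrow> transl (s + t) \<in> W"
  using W_comp[of "transl s" "transl t"] by (simp add: transl_def comp_def add.assoc[symmetric])
     (simp add: transl_def[abs_def] add.assoc)

lemma transl_0: "transl 0 = id"
  by (simp add: transl_def fun_eq_iff)

lemma transl_nat_W: "transl t \<in> W \<Longrightarrow> transl (of_nat n *\<^sub>R t) \<in> W"
proof (induction n)
  case 0
  show ?case
    using W_id transl_0 by (metis scaleR_zero_left of_nat_0 sum.empty)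
next
  case (Suc n)
  then show ?case using transl_add_W[of t "of_nat n *\<^sub>R t"] by (simp add: scaleR_add_left)
qed

lemma transl_int_W: "transl t \<in> W \<Longrightarrow> transl (of_int n *\<^sub>R t) \<in> W"
  using transl_nat_W[of t "nat n"] transl_minus_W[OF transl_nat_W[of t "nat (- n)"]]
  by (cases "n \<ge> 0") simp_all

lemma transl_sum_W: "finite A \<Longrightarrow> (\<And>a. a \<in> A \<Longrightarrow> transl (t a) \<in> W) \<Longrightarrow> transl (sum t A) \<in> W"
proof (induction A rule: finite_induct)
  case empty
  show ?case
    using W_id transl_0 by (metis scaleR_zero_left of_nat_0 sum.empty)
qed (simp add: transl_add_W)

lemma grad_transl [simp]: "grad (transl t) = id"
  by (rule grad_eqI) (simp add: transl_def pairing_linear)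

text \<open>
  The group contains the translations by the lattice that the coroots generate. Write \<open>\<omega>\<close> as a real
  combination of coroots and split \<open>n \<omega>\<close> into its integral and its fractional part. On the roots the
  fractional part takes integral values bounded independently of \<open>n\<close>, so it repeats, and the
  difference of two multiples of \<open>\<omega>\<close> with the same fractional part lies in the lattice.
\<close>

lemma transl_multiple_W:
  assumes int: "\<And>\<alpha>. \<alpha> \<in> \<Phi> \<Longrightarrow> pairing \<alpha> \<omega> \<in> \<int>"
  obtains d :: nat where "d > 0" "transl (of_nat d *\<^sub>R \<omega>) \<in> W"
proof -
  obtain c where c: "\<omega> = (\<Sum>\<beta>\<in>\<Phi>. c \<beta> *\<^sub>R co \<beta>)"
    using coroots_span by blast
  (* integral part q n and fractional part r n of n times omega *)
  define q where "q n = (\<Sum>\<beta>\<in>\<Phi>. of_int \<lfloor>of_nat n * c \<beta>\<rfloor> *\<^sub>R co \<beta>)" for n :: nat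
  define r where "r n = of_nat n *\<^sub>R \<omega> - q n" for n :: nat
  define B where "B = (\<Sum>\<alpha>\<in>\<Phi>. \<Sum>\<beta>\<in>\<Phi>. \<bar>pairing \<alpha> (co \<beta>)\<bar>)"
  have q_W: "transl (q n) \<in> W" for n
    unfolding q_def by (intro transl_sum_W transl_int_W transl_coroot_W finite_roots)
  have q_int: "pairing \<alpha> (q n) \<in> \<int>" if "\<alpha> \<in> \<Phi>" for \<alpha> n
    using pairing_W_Ints[OF q_W that] by (simp add: transl_def)
  have r_int: "pairing \<alpha> (r n) \<in> \<int>" if "\<alpha> \<in> \<Phi>" for \<alpha> n
    using q_int[OF that] int[OF that] by (simp add: r_def pairing_linear)
  have r_bound: "\<bar>pairing \<alpha> (r n)\<bar> \<le> B" if "\<alpha> \<in> \<Phi>" for \<alpha> n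
  proof -
    have "r n = (\<Sum>\<beta>\<in>\<Phi>. frac (of_nat n * c \<beta>) *\<^sub>R co \<beta>)"
      by (simp add: r_def q_def c frac_def scaleR_sum_right sum_subtractf scaleR_left_diff_distrib)
    then have "\<bar>pairing \<alpha> (r n)\<bar> \<le> (\<Sum>\<beta>\<in>\<Phi>. \<bar>frac (of_nat n * c \<beta>) * pairing \<alpha> (co \<beta>)\<bar>)"
      by (simp add: blinfun.sum_left blinfun.scaleR_left)
    also have "\<dots> \<le> (\<Sum>\<beta>\<in>\<Phi>. \<bar>pairing \<alpha> (co \<beta>)\<bar>)"
    proof (rule sum_mono)
      fix \<beta>
      have "0 \<le> frac (of_nat n * c \<beta>)" "frac (of_nat n * c \<beta>) \<le> 1"
        using frac_lt_1 less_imp_le by auto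
      then show "\<bar>frac (of_nat n * c \<beta>) * pairing \<alpha> (co \<beta>)\<bar> \<le> \<bar>pairing \<alpha> (co \<beta>)\<bar>"
        by (simp add: abs_mult mult_left_le_one_le)
    qed
    also have "\<dots> \<le> B"
      unfolding B_def using that finite_roots
      by (intro member_le_sum[of \<alpha> \<Phi> "\<lambda>\<alpha>. \<Sum>\<beta>\<in>\<Phi>. \<bar>pairing \<alpha> (co \<beta>)\<bar>"]) (auto intro: sum_nonneg)
    finally show ?thesis .
  qed
  define F where "F n = restrict (\<lambda>\<alpha>. \<lfloor>pairing \<alpha> (r n)\<rfloor>) \<Phi>" for n
  have "range F \<subseteq> (\<Pi>\<^sub>E \<alpha>\<in>\<Phi>. {\<lfloor>- B\<rfloor>..\<lfloor>B\<rfloor>})"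
    using r_bound by (auto simp: F_def abs_le_iff intro!: floor_mono) (smt (verit) floor_mono)
  then have "finite (range F)"
    using finite_roots by (meson finite_PiE finite_atLeastAtMost_int finite_subset)
  then have "\<not> inj F"
    using finite_imageD infinite_UNIV_nat by blast
  then obtain m n where mn: "F m = F n" "m < n"
    by (metis injI linorder_neqE_nat)
  have "r m = r n"
  proof (rule dual_eqI_spanning[OF span_roots])
    fix \<alpha> assume \<alpha>: "\<alpha> \<in> \<Phi>"
    then have "\<lfloor>pairing \<alpha> (r m)\<rfloor> = \<lfloor>pairing \<alpha> (r n)\<rfloor>"
      using mn(1) by (metis F_def restrict_apply')
    then show "pairing \<alpha> (r m) = pairing \<alpha> (r n)"
      using r_int[OF \<alpha>] by (metis Ints_cases floor_of_int)
  qed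
  then have "of_nat (n - m) *\<^sub>R \<omega> = q n + - q m"
    using mn(2) by (simp add: r_def of_nat_diff scaleR_left_diff_distrib algebra_simps)
  then have "transl (of_nat (n - m) *\<^sub>R \<omega>) \<in> W"
    using transl_add_W[OF q_W transl_minus_W[OF q_W]] by metis
  then show ?thesis
    using that[of "n - m"] mn(2) by simp
qed

section \<open>Bases\<close>

lemma
  assumes B: "root_base \<Phi> B"
  shows base_subset: "B \<subseteq> \<Phi>" and base_finite: "finite B"
    and base_independent: "independent B" and base_span: "span B = UNIV"
  using B finite_roots by (auto simp: root_base_def intro: finite_subset)

lemma coef_linear:
  assumes B: "root_base \<Phi> B"
  shows "representation B (u + v) b = representation B u b + representation B v b"
    and "representation B (u - v) b = representation B u b - representation B v b"
    and "representation B (- u) b = - representation B u b"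
    and "representation B (c *\<^sub>R u) b = c * representation B u b"
    and "representation B 0 b = 0"
  using base_independent[OF B] base_span[OF B]
  by (simp_all add: representation_add representation_diff representation_neg representation_scale
      representation_zero)

lemma coef_base:
  assumes B: "root_base \<Phi> B" and "b \<in> B"
  shows "representation B b b' = (if b' = b then 1 else 0)"
  using representation_basis[OF base_independent[OF B] assms(2)] by simp

lemma base_expand:
  assumes B: "root_base \<Phi> B"
  shows "v = (\<Sum>b\<in>B. representation B v b *\<^sub>R b)"
  using sum_representation_eq[OF base_independent[OF B] _ base_finite[OF B] order_refl]
    base_span[OF B] by simp

lemma base_eqI:
  assumes B: "root_base \<Phi> B" and "\<And>b. b \<in> B \<Longrightarrow> representation B u b = representation B v b"
  shows "u = v"
proof -
  have "u = (\<Sum>b\<in>B. representation B u b *\<^sub>R b)" by (rule base_expand[OF B])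
  also have "\<dots> = (\<Sum>b\<in>B. representation B v b *\<^sub>R b)" using assms(2) by simp
  also have "\<dots> = v" by (rule base_expand[OF B, symmetric])
  finally show ?thesis .
qed

lemma coef_nat_combination:
  assumes B: "root_base \<Phi> B" and "b \<in> B"
  shows "representation B (\<Sum>a\<in>B. real (c a) *\<^sub>R a) b = real (c b)"
proof -
  have "representation B (\<Sum>a\<in>B. real (c a) *\<^sub>R a) b
      = (\<Sum>a\<in>B. real (c a) * representation B a b)"
    using base_independent[OF B] base_span[OF B]
    by (simp add: representation_sum representation_scale)
  also have "\<dots> = (\<Sum>a\<in>B. if a = b then real (c a) else 0)"
    by (intro sum.cong) (auto simp: coef_base[OF B])
  also have "\<dots> = real (c b)"
    using assms(2) base_finite[OF B] by simp
  finally show ?thesis .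
qed

lemma root_coef:
  assumes B: "root_base \<Phi> B" and "\<beta> \<in> \<Phi>"
  shows "(\<forall>b\<in>B. representation B \<beta> b \<ge> 0) \<or> (\<forall>b\<in>B. representation B \<beta> b \<le> 0)"
    and "b \<in> B \<Longrightarrow> representation B \<beta> b \<in> \<int>"
proof -
  obtain c :: "'v \<Rightarrow> nat" where c: "\<beta> = (\<Sum>\<alpha>\<in>B. real (c \<alpha>) *\<^sub>R \<alpha>) \<or> \<beta> = - (\<Sum>\<alpha>\<in>B. real (c \<alpha>) *\<^sub>R \<alpha>)"
    using assms unfolding root_base_def by blast
  then have *: "(\<forall>b\<in>B. representation B \<beta> b = real (c b)) \<or> (\<forall>b\<in>B. representation B \<beta> b = - real (c b))"
    using coef_nat_combination[OF B] by (auto simp: coef_linear[OF B])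
  then show "(\<forall>b\<in>B. representation B \<beta> b \<ge> 0) \<or> (\<forall>b\<in>B. representation B \<beta> b \<le> 0)"
    by fastforce
  show "b \<in> B \<Longrightarrow> representation B \<beta> b \<in> \<int>"
    using * by auto
qed

end

section \<open>Positive affine roots\<close>

locale affine_roots = roots +
  fixes \<Delta> :: "'a set" and \<theta> :: 'a
  assumes reduced: "\<And>\<alpha> c. \<alpha> \<in> \<Phi> \<Longrightarrow> c *\<^sub>R \<alpha> \<in> \<Phi> \<Longrightarrow> c = 1 \<or> c = -1"
    and base: "root_base \<Phi> \<Delta>"
    and highest: "highest_root \<Phi> \<Delta> \<theta>"
begin

abbreviation coef :: "'a \<Rightarrow> 'a \<Rightarrow> real" where
  "coef \<equiv> representation \<Delta>"

lemma base_root: "\<delta> \<in> \<Delta> \<Longrightarrow> \<delta> \<in> \<Phi>"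
  using base_subset[OF base] by blast

lemma highest_in: "\<theta> \<in> \<Phi>"
  using highest by (simp add: highest_root_def)

lemma coef_highest: "\<beta> \<in> \<Phi> \<Longrightarrow> \<delta> \<in> \<Delta> \<Longrightarrow> coef \<beta> \<delta> \<le> coef \<theta> \<delta>"
proof -
  assume \<beta>: "\<beta> \<in> \<Phi>" "\<delta> \<in> \<Delta>"
  then obtain c :: "'a \<Rightarrow> nat" where "\<theta> - \<beta> = (\<Sum>\<alpha>\<in>\<Delta>. real (c \<alpha>) *\<^sub>R \<alpha>)"
    using highest unfolding highest_root_def by blast
  then have "coef (\<theta> - \<beta>) \<delta> = real (c \<delta>)"
    using coef_nat_combination[OF base \<beta>(2)] by simp
  then show ?thesis
    by (simp add: coef_linear[OF base])
qed

lemma coef_highest_nonneg: "\<delta> \<in> \<Delta> \<Longrightarrow> 0 \<le> coef \<theta> \<delta>"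
  using coef_highest[OF minus_root[OF highest_in], of \<delta>] by (simp add: coef_linear[OF base])

text \<open>
  The functional \<open>x \<mapsto> \<langle>\<alpha>, x\<rangle> + k\<close> is positive on the fundamental alcove iff \<open>k > 0\<close>, or \<open>k = 0\<close>
  and \<open>\<alpha>\<close> is a positive root. So the admissible \<open>k\<close> are those from \<open>least_level \<alpha>\<close> on.
\<close>

definition least_level :: "'a \<Rightarrow> int" where
  "least_level \<alpha> = (if \<forall>\<delta>\<in>\<Delta>. coef \<alpha> \<delta> \<ge> 0 then 0 else 1)"

definition aff_pos :: "'a \<times> int \<Rightarrow> bool" where
  "aff_pos a \<longleftrightarrow> fst a \<in> \<Phi> \<and> least_level (fst a) \<le> snd a"

lemma least_level_minus: "\<alpha> \<in> \<Phi> \<Longrightarrow> least_level (- \<alpha>) = 1 - least_level \<alpha>"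
proof -
  assume \<alpha>: "\<alpha> \<in> \<Phi>"
  have "\<not> ((\<forall>\<delta>\<in>\<Delta>. coef \<alpha> \<delta> \<ge> 0) \<and> (\<forall>\<delta>\<in>\<Delta>. coef \<alpha> \<delta> \<le> 0))"
  proof
    assume "(\<forall>\<delta>\<in>\<Delta>. coef \<alpha> \<delta> \<ge> 0) \<and> (\<forall>\<delta>\<in>\<Delta>. coef \<alpha> \<delta> \<le> 0)"
    then have "\<alpha> = 0"
      by (intro base_eqI[OF base]) (force simp: coef_linear[OF base] intro: antisym)
    then show False
      using \<alpha> zero_not_root by simp
  qed
  then show ?thesis
    using root_coef(1)[OF base \<alpha>] by (auto simp: least_level_def coef_linear[OF base])
qed

lemma aff_pos_neg: "fst a \<in> \<Phi> \<Longrightarrow> aff_pos (neg a) \<longleftrightarrow> \<not> aff_pos a"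
  using least_level_minus[of "fst a"] minus_root by (auto simp: aff_pos_def)

text \<open>
  The functional \<open>\<langle>\<alpha>, _\<rangle> + k\<close> is the sum of the \<open>aff_coef (\<alpha>, k) \<delta>\<close>-multiples of the simple roots
  \<open>\<delta>\<close> and of \<open>k\<close> times the remaining simple affine functional \<open>1 - \<langle>\<theta>, _\<rangle>\<close>.
\<close>

definition aff_coef :: "'a \<times> int \<Rightarrow> 'a \<Rightarrow> real" where
  "aff_coef a \<delta> = coef (fst a) \<delta> + of_int (snd a) * coef \<theta> \<delta>"

lemma aff_pos_coef:
  assumes "aff_pos a"
  shows "0 \<le> snd a" and "\<delta> \<in> \<Delta> \<Longrightarrow> 0 \<le> aff_coef a \<delta>"
proof -
  show k: "0 \<le> snd a"
    using assms by (auto simp: aff_pos_def least_level_def split: if_splits)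
  assume \<delta>: "\<delta> \<in> \<Delta>"
  show "0 \<le> aff_coef a \<delta>"
  proof (cases "snd a = 0")
    case True
    then show ?thesis
      using assms \<delta> by (auto simp: aff_pos_def least_level_def aff_coef_def split: if_splits)
  next
    case False
    then have "1 * coef \<theta> \<delta> \<le> of_int (snd a) * coef \<theta> \<delta>"
      using k coef_highest_nonneg[OF \<delta>] by (intro mult_right_mono) auto
    moreover have "- coef (fst a) \<delta> \<le> coef \<theta> \<delta>"
      using coef_highest[OF minus_root \<delta>, of "fst a"] assms
      by (simp add: aff_pos_def coef_linear[OF base])
    ultimately show ?thesis
      by (simp add: aff_coef_def)
  qed
qed

lemma aff_posI:
  assumes "fst a \<in> \<Phi>" and "snd a > 0 \<or> (\<exists>\<delta>\<in>\<Delta>. aff_coef a \<delta> > 0)"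
  shows "aff_pos a"
proof (rule ccontr)
  assume "\<not> aff_pos a"
  then have "aff_pos (neg a)"
    using assms(1) aff_pos_neg by blast
  then have "0 \<le> - snd a" "\<And>\<delta>. \<delta> \<in> \<Delta> \<Longrightarrow> 0 \<le> - aff_coef a \<delta>"
    using aff_pos_coef[of "neg a"] by (auto simp: aff_coef_def coef_linear[OF base])
  then show False
    using assms(2) by force
qed

definition simples :: "('a \<times> int) set" where
  "simples = (\<lambda>\<delta>. (\<delta>, 0)) ` \<Delta> \<union> {(- \<theta>, 1)}"

lemma aff_coef_simple:
  assumes "a \<in> simples"
  shows "(\<exists>\<delta>\<in>\<Delta>. a = (\<delta>, 0) \<and> (\<forall>\<epsilon>. aff_coef a \<epsilon> = (if \<epsilon> = \<delta> then 1 else 0))) \<or>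
         a = (- \<theta>, 1) \<and> (\<forall>\<epsilon>. aff_coef a \<epsilon> = 0)"
  using assms by (auto simp: simples_def aff_coef_def coef_base[OF base] coef_linear[OF base])

lemma simple_root: "a \<in> simples \<Longrightarrow> fst a \<in> \<Phi>"
  using base_root highest_in minus_root by (auto simp: simples_def)

lemma simple_pos: "a \<in> simples \<Longrightarrow> aff_pos a"
  using aff_coef_simple[of a] simple_root[of a] by (intro aff_posI) force+

text \<open>
  The reflection in \<open>a\<close> subtracts a multiple of \<open>a\<close> from \<open>b\<close>, hence leaves the coefficients at the
  other simple affine functionals alone. Some such coefficient of \<open>b\<close> is positive, since otherwise
  \<open>b\<close> would be a multiple of \<open>a\<close>, that is \<open>a\<close> itself in a reduced root system; and one positive
  coefficient already makes an affine root positive.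
\<close>

lemma simple_act_pos:
  assumes a: "a \<in> simples" and b: "aff_pos b" "b \<noteq> a"
  shows "aff_pos (aff_act (aff_refl a) b)"
proof -
  have roots: "fst a \<in> \<Phi>" "fst b \<in> \<Phi>"
    using a b simple_root by (auto simp: aff_pos_def)
  obtain n where act: "aff_act (aff_refl a) b = (fst b - of_int n *\<^sub>R fst a, snd b - n * snd a)"
    using aff_act_refl[OF roots] by metis
  have in_roots: "fst (aff_act (aff_refl a) b) \<in> \<Phi>"
    using aff_act_root aff_refl_W roots by blast
  have coef: "aff_coef (aff_act (aff_refl a) b) \<epsilon> = aff_coef b \<epsilon> - of_int n * aff_coef a \<epsilon>" for \<epsilon>
    by (simp add: act aff_coef_def coef_linear[OF base] algebra_simps)
  show ?thesis
  proof (cases "\<exists>\<epsilon>\<in>\<Delta>. aff_coef b \<epsilon> > 0 \<and> aff_coef a \<epsilon> = 0")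
    case True
    then show ?thesis
      using coef by (intro aff_posI[OF in_roots]) fastforce
  next
    case False
    then have zero: "aff_coef b \<epsilon> = 0" if "\<epsilon> \<in> \<Delta>" "aff_coef a \<epsilon> = 0" for \<epsilon>
      using aff_pos_coef(2)[OF b(1) that(1)] that by force
    consider (fin) \<delta> where "\<delta> \<in> \<Delta>" "a = (\<delta>, 0)" "\<And>\<epsilon>. aff_coef a \<epsilon> = (if \<epsilon> = \<delta> then 1 else 0)"
      | (aff) "a = (- \<theta>, 1)" "\<And>\<epsilon>. aff_coef a \<epsilon> = 0"
      using aff_coef_simple[OF a] by blast
    then show ?thesis
    proof cases
      case fin
      show ?thesis
      proof (cases "snd b > 0")
        case True
        then show ?thesis
          using arg_cong[OF act, of snd] fin(2) by (intro aff_posI[OF in_roots]) simp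
      next
        case False
        then have b0: "snd b = 0"
          using aff_pos_coef(1)[OF b(1)] by simp
        have "coef (fst b) \<epsilon> = 0" if "\<epsilon> \<in> \<Delta>" "\<epsilon> \<noteq> \<delta>" for \<epsilon>
          using zero[OF that(1)] fin(3)[of \<epsilon>] that(2) by (simp add: aff_coef_def[of b] b0)
        then have "fst b = coef (fst b) \<delta> *\<^sub>R \<delta>"
          by (intro base_eqI[OF base]) (simp add: coef_linear[OF base] coef_base[OF base fin(1)])
        moreover have "coef (fst b) \<delta> \<ge> 0"
          using aff_pos_coef(2)[OF b(1) fin(1)] by (simp add: aff_coef_def b0)
        ultimately have "fst b = \<delta>"
          using reduced[OF base_root[OF fin(1)], of "coef (fst b) \<delta>"] roots(2) by fastforce
        then have "b = a"
          using b0 fin(2) by (simp add: prod_eq_iff)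
        then show ?thesis using b(2) by blast
      qed
    next
      case aff
      have "fst b = (- of_int (snd b)) *\<^sub>R \<theta>"
        using zero aff(2) by (intro base_eqI[OF base])
          (force simp: coef_linear[OF base] aff_coef_def eq_neg_iff_add_eq_0)
      moreover from this have "- real_of_int (snd b) = 1 \<or> - real_of_int (snd b) = - 1"
        using reduced[OF highest_in] roots(2) by metis
      ultimately have "b = a"
        using aff_pos_coef(1)[OF b(1)] aff(1) by (auto simp: prod_eq_iff)
      then show ?thesis using b(2) by blast
    qed
  qed
qed

section \<open>Generation by the simple reflections\<close>

abbreviation S :: "('a dual \<Rightarrow> 'a dual) set" where
  "S \<equiv> affine_simple_reflections \<Phi> \<Delta> \<theta>"

lemma S_eq: "S = aff_refl ` simples"
proof -
  have "aff_refl (- \<theta>, 1) = affine_reflection \<Phi> \<theta> 1"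
    using aff_refl_neg[of "(\<theta>, -1)"] highest_in by (simp add: aff_refl_def)
  moreover have "aff_refl ` (\<lambda>\<delta>. (\<delta>, 0)) ` \<Delta> = (\<lambda>\<alpha>. affine_reflection \<Phi> \<alpha> 0) ` \<Delta>"
    by (simp add: image_image aff_refl_def)
  ultimately show ?thesis
    by (simp add: affine_simple_reflections_def simple_reflections_def simples_def image_Un)
qed

lemma finite_S: "finite S"
  using base_finite[OF base] by (simp add: S_eq simples_def)

lemma S_subset_W: "S \<subseteq> W"
  using aff_refl_W simple_root by (auto simp: S_eq)

definition word :: "('a dual \<Rightarrow> 'a dual) list \<Rightarrow> 'a dual \<Rightarrow> 'a dual" where
  "word ss = foldr (\<circ>) ss id"

lemma word_simps [simp]: "word [] = id" "word (s # ss) = s \<circ> word ss"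
  by (simp_all add: word_def)

lemma word_append: "word (ss @ ts) = word ss \<circ> word ts"
  by (induction ss) (auto simp: comp_def)

lemma word_W: "set ss \<subseteq> S \<Longrightarrow> word ss \<in> W"
proof (induction ss)
  case Nil
  show ?case using W_id word_simps(1) by metis
next
  case (Cons s ss)
  then show ?case using S_subset_W W_comp[of s "word ss"] by (auto simp: comp_def)
qed

text \<open>
  The summand \<open>snd a\<close> is the coefficient at \<open>1 - \<langle>\<theta>, _\<rangle>\<close>, so that every simple affine root has height 1.
\<close>

definition height :: "'a \<times> int \<Rightarrow> real" where
  "height a = of_int (snd a) + (\<Sum>\<delta>\<in>\<Delta>. aff_coef a \<delta>)"

lemma height_simple:
  assumes "a \<in> simples"
  shows "height a = 1"
  using aff_coef_simple[OF assms] base_finite[OF base] by (auto simp: height_def)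

lemma height_nonneg: "aff_pos a \<Longrightarrow> 0 \<le> height a"
  using aff_pos_coef[of a] by (auto simp: height_def intro!: add_nonneg_nonneg sum_nonneg)

text \<open>
  Expand \<open>\<langle>\<alpha>, \<alpha>\<^sup>\<or>\<rangle> = 2\<close> in the simple affine functionals: one of them must pair positively with
  \<open>\<alpha>\<^sup>\<or>\<close>, and the sign of the pairing is symmetric in the two roots.
\<close>

lemma exists_lowering_simple:
  assumes "aff_pos a"
  obtains s where "s \<in> simples" "pairing (fst a) (co (fst s)) > 0"
proof -
  let ?\<alpha> = "fst a"
  have \<alpha>: "?\<alpha> \<in> \<Phi>" using assms by (simp add: aff_pos_def)
  have "?\<alpha> + of_int (snd a) *\<^sub>R \<theta> = (\<Sum>\<delta>\<in>\<Delta>. aff_coef a \<delta> *\<^sub>R \<delta>)"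
    using base_expand[OF base, of "?\<alpha> + of_int (snd a) *\<^sub>R \<theta>"]
    by (simp add: aff_coef_def coef_linear[OF base])
  then have "?\<alpha> = (\<Sum>\<delta>\<in>\<Delta>. aff_coef a \<delta> *\<^sub>R \<delta>) + of_int (snd a) *\<^sub>R (- \<theta>)"
    by (simp add: algebra_simps)
  then have "pairing ?\<alpha> (co ?\<alpha>) = pairing ((\<Sum>\<delta>\<in>\<Delta>. aff_coef a \<delta> *\<^sub>R \<delta>) + of_int (snd a) *\<^sub>R (- \<theta>)) (co ?\<alpha>)"
    by (rule arg_cong)
  then have eq: "2 = (\<Sum>\<delta>\<in>\<Delta>. aff_coef a \<delta> * pairing \<delta> (co ?\<alpha>)) + of_int (snd a) * pairing (- \<theta>) (co ?\<alpha>)"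
    using \<alpha> by (simp add: pairing_linear)
  have "\<exists>s\<in>simples. pairing (fst s) (co ?\<alpha>) > 0"
  proof (rule ccontr)
    assume neg: "\<not> ?thesis"
    then have "pairing \<delta> (co ?\<alpha>) \<le> 0" if "\<delta> \<in> \<Delta>" for \<delta>
      using that by (force simp: simples_def)
    moreover have "pairing (- \<theta>) (co ?\<alpha>) \<le> 0"
      using neg by (force simp: simples_def)
    ultimately have "(\<Sum>\<delta>\<in>\<Delta>. aff_coef a \<delta> * pairing \<delta> (co ?\<alpha>)) \<le> 0"
      "of_int (snd a) * pairing (- \<theta>) (co ?\<alpha>) \<le> 0"
      using aff_pos_coef[OF assms] by (auto intro!: sum_nonpos mult_nonneg_nonpos)
    then show False using eq by linarith
  qed
  then show ?thesis
    using that pairing_coroot_pos_sym[OF _ \<alpha>] simple_root by blast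
qed

text \<open>
  Conjugation by suitable simple reflections lowers the height of an affine root until it is simple.
\<close>

lemma aff_refl_word:
  "aff_pos a \<Longrightarrow> \<exists>ss. set ss \<subseteq> S \<and> word ss = aff_refl a"
proof (induction "nat \<lfloor>height a\<rfloor>" arbitrary: a rule: less_induct)
  case less
  show ?case
  proof (cases "a \<in> simples")
    case True
    then show ?thesis
      by (intro exI[of _ "[aff_refl a]"]) (auto simp: S_eq)
  next
    case False
    obtain s where s: "s \<in> simples" "pairing (fst a) (co (fst s)) > 0"
      using exists_lowering_simple[OF less.prems] by blast
    have roots: "fst s \<in> \<Phi>" "fst a \<in> \<Phi>"
      using s simple_root less.prems by (auto simp: aff_pos_def)
    define b where "b = aff_act (aff_refl s) a"
    obtain n where n: "pairing (fst a) (co (fst s)) = of_int n"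
      "b = (fst a - of_int n *\<^sub>R fst s, snd a - n * snd s)"
      using aff_act_refl[OF roots] unfolding b_def by metis
    have b: "aff_pos b"
      unfolding b_def using simple_act_pos[OF s(1) less.prems] False s(1) by blast
    have "aff_coef b \<delta> = aff_coef a \<delta> - of_int n * aff_coef s \<delta>" for \<delta>
      by (simp add: n(2) aff_coef_def coef_linear[OF base] algebra_simps)
    then have "(\<Sum>\<delta>\<in>\<Delta>. aff_coef b \<delta>) = (\<Sum>\<delta>\<in>\<Delta>. aff_coef a \<delta>) - of_int n * (\<Sum>\<delta>\<in>\<Delta>. aff_coef s \<delta>)"
      by (simp add: sum_subtractf sum_distrib_left)
    moreover have "real_of_int (snd b) = of_int (snd a) - of_int n * of_int (snd s)"
      by (simp add: n(2))
    ultimately have "height b = height a - of_int n * height s"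
      by (simp add: height_def algebra_simps)
    then have "\<lfloor>height a\<rfloor> = \<lfloor>height b\<rfloor> + n"
      using height_simple[OF s(1)] by simp
    moreover have "n > 0" "\<lfloor>height b\<rfloor> \<ge> 0"
      using s(2) n(1) height_nonneg[OF b] by auto
    ultimately have "nat \<lfloor>height b\<rfloor> < nat \<lfloor>height a\<rfloor>"
      by linarith
    then obtain ss where ss: "set ss \<subseteq> S" "word ss = aff_refl b"
      using less.hyps[OF _ b] by blast
    have "aff_refl a = aff_refl a \<circ> (aff_refl s \<circ> aff_refl s)"
      using aff_refl_involution[OF roots(1)] by simp
    also have "\<dots> = aff_refl s \<circ> aff_refl b \<circ> aff_refl s"
      using aff_refl_conj[OF aff_refl_W[OF roots(1)] roots(2)] unfolding b_def
      by (metis comp_assoc)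
    finally have "word (aff_refl s # ss @ [aff_refl s]) = aff_refl a"
      using ss(2) by (simp add: word_append comp_assoc)
    then show ?thesis
      using ss(1) s(1) by (intro exI[of _ "aff_refl s # ss @ [aff_refl s]"]) (auto simp: S_eq)
  qed
qed

lemma W_word:
  assumes "w \<in> W"
  shows "\<exists>ss. set ss \<subseteq> S \<and> word ss = w"
  using assms
proof (induction rule: W_induct)
  case id
  show ?case by (intro exI[of _ "[]"]) simp
next
  case (refl \<alpha> k)
  have eq: "affine_reflection \<Phi> \<alpha> k = aff_refl (\<alpha>, - k)"
    by (simp add: aff_refl_def)
  have "aff_pos (\<alpha>, - k) \<or> aff_pos (neg (\<alpha>, - k))"
    using aff_pos_neg[of "(\<alpha>, - k)"] refl by auto
  then show ?case
    using aff_refl_word[of "(\<alpha>, - k)"] aff_refl_word[of "neg (\<alpha>, - k)"] aff_refl_neg[of "(\<alpha>, - k)"] refl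
    unfolding eq by (metis fst_conv)
next
  case (comp u w)
  then obtain ss ts where "set ss \<subseteq> S" "word ss = u" "set ts \<subseteq> S" "word ts = w" by blast
  then show ?case
    by (intro exI[of _ "ss @ ts"]) (auto simp: word_append comp_def)
qed

section \<open>The length function\<close>

definition inversions :: "('a dual \<Rightarrow> 'a dual) \<Rightarrow> ('a \<times> int) set" where
  "inversions w = {a. aff_pos a \<and> \<not> aff_pos (aff_act w a)}"

lemma inversions_eq:
  assumes "w \<in> W"
  shows "inversions w =
    (SIGMA \<alpha>:\<Phi>. {least_level \<alpha>..<least_level (grad w \<alpha>) - \<lfloor>pairing \<alpha> (w 0)\<rfloor>})"
  using assms grad_in by (auto simp: inversions_def aff_pos_def aff_act_def)

lemma finite_inversions: "w \<in> W \<Longrightarrow> finite (inversions w)"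
  using finite_roots by (auto simp: inversions_eq)

lemma card_inversions:
  "w \<in> W \<Longrightarrow> card (inversions w) =
    (\<Sum>\<alpha>\<in>\<Phi>. nat (least_level (grad w \<alpha>) - \<lfloor>pairing \<alpha> (w 0)\<rfloor> - least_level \<alpha>))"
  using finite_roots by (simp add: inversions_eq)

text \<open>
  The reflection in \<open>s\<close> permutes the positive affine roots other than \<open>s\<close>, and \<open>s\<close> itself is the
  additional inversion.
\<close>

lemma card_inversions_step:
  assumes w: "w \<in> W" and s: "s \<in> simples" and pos: "aff_pos (aff_act w s)"
  shows "card (inversions (aff_refl s \<circ> w)) = Suc (card (inversions w))"
proof -
  let ?f = "aff_act (aff_refl s)"
  have sr: "fst s \<in> \<Phi>" and sW: "aff_refl s \<in> W"
    using s simple_root aff_refl_W by auto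
  have act: "aff_act (aff_refl s \<circ> w) b = aff_act w (?f b)" if "fst b \<in> \<Phi>" for b
    using aff_act_comp[OF sW w that] .
  have "inversions (aff_refl s \<circ> w) = insert s (?f ` inversions w)"
  proof (intro equalityI subsetI)
    fix b assume b: "b \<in> inversions (aff_refl s \<circ> w)"
    then have bp: "aff_pos b" "\<not> aff_pos (aff_act (aff_refl s \<circ> w) b)"
      by (simp_all add: inversions_def)
    then have br: "fst b \<in> \<Phi>" by (simp add: aff_pos_def)
    note bp = bp(1) bp(2)[unfolded act[OF br]]
    show "b \<in> insert s (?f ` inversions w)"
    proof (cases "b = s")
      case False
      then have "?f b \<in> inversions w"
        using simple_act_pos[OF s bp(1)] bp(2) by (simp add: inversions_def)
      then show ?thesis
        using aff_act_refl_involution[OF sr br] by (metis insertCI imageI)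
    qed simp
  next
    fix b assume "b \<in> insert s (?f ` inversions w)"
    then consider "b = s" | c where "c \<in> inversions w" "b = ?f c" by blast
    then show "b \<in> inversions (aff_refl s \<circ> w)"
    proof cases
      case 1
      have "aff_act (aff_refl s \<circ> w) s = neg (aff_act w s)"
        using act[OF sr] aff_act_refl_self[OF sr] aff_act_neg[OF w sr] by simp
      then show ?thesis
        using 1 pos aff_pos_neg[of "aff_act w s"] aff_act_root[OF w sr] simple_pos[OF s]
        by (simp add: inversions_def)
    next
      case 2
      then have c: "aff_pos c" "\<not> aff_pos (aff_act w c)" "fst c \<in> \<Phi>"
        by (auto simp: inversions_def aff_pos_def)
      have "c \<noteq> s" using c(2) pos by blast
      then have "aff_pos b"
        using simple_act_pos[OF s c(1)] 2 by blast
      moreover have "aff_act (aff_refl s \<circ> w) b = aff_act w c"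
        using act[of b] aff_act_root[OF sW c(3)] aff_act_refl_involution[OF sr c(3)] 2 by simp
      ultimately show ?thesis
        using c(2) by (simp add: inversions_def)
    qed
  qed
  moreover have "s \<notin> ?f ` inversions w"
  proof
    assume "s \<in> ?f ` inversions w"
    then obtain c where c: "s = ?f c" "aff_pos c" by (auto simp: inversions_def)
    then have "c = neg s"
      using aff_act_refl_involution[OF sr, of c] aff_act_refl_self[OF sr] by (simp add: aff_pos_def)
    then show False
      using aff_pos_neg[OF sr] simple_pos[OF s] c(2) by blast
  qed
  moreover have "inj_on ?f (inversions w)"
    by (rule inj_on_inverseI[of _ ?f])
       (use aff_act_refl_involution[OF sr] in \<open>auto simp: inversions_def aff_pos_def\<close>)
  ultimately show ?thesis
    using finite_inversions[OF w] by (simp add: card_image)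
qed

text \<open>
  Read \<open>ss\<close> from the left and follow \<open>s\<close> under composition with longer and longer prefixes. At the
  letter where the affine root turns negative it equals the simple root of that letter, so
  multiplication by the reflection in \<open>s\<close> deletes the letter.
\<close>

lemma exchange:
  assumes "set ss \<subseteq> S" "s \<in> simples" "\<not> aff_pos (aff_act (word ss) s)"
  shows "\<exists>ts. set ts \<subseteq> S \<and> Suc (length ts) = length ss \<and> word ts = aff_refl s \<circ> word ss"
  using assms(1,3)
proof (induction ss rule: rev_induct)
  case Nil
  have "aff_act (word []) s = s" by simp
  then show ?case using simple_pos[OF assms(2)] Nil(2) by metis
next
  case (snoc t ss)
  have sr: "fst s \<in> \<Phi>" using assms(2) simple_root by blast
  obtain \<tau> where \<tau>: "\<tau> \<in> simples" "t = aff_refl \<tau>"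
    using snoc.prems by (auto simp: S_eq)
  have W: "word ss \<in> W" "t \<in> W"
    using snoc.prems word_W S_subset_W by auto
  have w: "word (ss @ [t]) = word ss \<circ> t"
    by (simp add: word_append)
  show ?case
  proof (cases "aff_pos (aff_act (word ss) s)")
    case False
    then obtain ts where ts: "set ts \<subseteq> S" "Suc (length ts) = length ss" "word ts = aff_refl s \<circ> word ss"
      using snoc.IH[OF _ False] snoc.prems(1) by (auto simp: comp_def)
    then show ?thesis
      using snoc.prems(1) by (intro exI[of _ "ts @ [t]"]) (auto simp: word_append comp_assoc)
  next
    case True
    have "\<not> aff_pos (aff_act (aff_refl \<tau>) (aff_act (word ss) s))"
      using snoc.prems(2) aff_act_comp[OF W sr] \<tau>(2) w by metis
    then have "aff_act (word ss) s = \<tau>"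
      using simple_act_pos[OF \<tau>(1) True] by blast
    then have "aff_refl s \<circ> word ss = word ss \<circ> t"
      using aff_refl_conj[OF W(1) sr] \<tau>(2) by simp
    then have "aff_refl s \<circ> word (ss @ [t]) = word ss \<circ> (t \<circ> t)"
      unfolding w by (metis comp_assoc)
    also have "t \<circ> t = id"
      using aff_refl_involution \<tau> simple_root by blast
    finally show ?thesis
      using snoc.prems(1) by (intro exI[of _ ss]) auto
  qed
qed

abbreviation len :: "('a dual \<Rightarrow> 'a dual) \<Rightarrow> nat" where
  "len \<equiv> cox_length (affine_weyl_group \<Phi>) S"

lemma foldr_mult_word:
  "set ss \<subseteq> S \<Longrightarrow> foldr (monoid.mult (affine_weyl_group \<Phi>)) ss \<one>\<^bsub>affine_weyl_group \<Phi>\<^esub> = word ss"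
proof (induction ss)
  case Nil
  show ?case by (simp add: one_W)
next
  case (Cons s ss)
  then show ?case
    using mult_W[of s "word ss"] word_W[of ss] S_subset_W by auto
qed

lemma len_eq_Least: "len w = (LEAST n. \<exists>ss. set ss \<subseteq> S \<and> length ss = n \<and> word ss = w)"
  unfolding cox_length_def using foldr_mult_word by (intro arg_cong[where f = Least]) (auto intro!: ext)

lemma len_le: "set ss \<subseteq> S \<Longrightarrow> len (word ss) \<le> length ss"
  unfolding len_eq_Least by (rule Least_le) blast

lemma reduced_word:
  assumes "w \<in> W"
  obtains ss where "set ss \<subseteq> S" "length ss = len w" "word ss = w"
proof -
  have "\<exists>ss. set ss \<subseteq> S \<and> length ss = len w \<and> word ss = w"
    unfolding len_eq_Least by (rule LeastI_ex) (use W_word[OF assms] in blast)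
  then show ?thesis using that by blast
qed

text \<open>
  Along a reduced word every further letter adds an inversion: if it did not, the exchange property
  would shorten the word.
\<close>

theorem len_eq_card_inversions: "w \<in> W \<Longrightarrow> len w = card (inversions w)"
proof (induction "len w" arbitrary: w)
  case 0
  obtain ss where "set ss \<subseteq> S" "length ss = len w" "word ss = w"
    using reduced_word[OF \<open>w \<in> W\<close>] by blast
  then have "w = id" using 0 by simp
  then have "inversions w = {}"
    by (simp add: inversions_def)
  then show ?case using 0 by simp
next
  case (Suc m)
  obtain ss where ss: "set ss \<subseteq> S" "length ss = len w" "word ss = w"
    using reduced_word[OF \<open>w \<in> W\<close>] by blast
  then obtain s ss' where ss': "ss = aff_refl s # ss'" "s \<in> simples" "set ss' \<subseteq> S" "length ss' = m"
    using Suc(2) by (cases ss) (auto simp: S_eq)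
  define u where "u = word ss'"
  have u: "u \<in> W" "w = aff_refl s \<circ> u"
    using word_W ss'(1,3) ss(3) by (auto simp: u_def)
  obtain ts where ts: "set ts \<subseteq> S" "length ts = len u" "word ts = u"
    using reduced_word[OF u(1)] by blast
  have "len w \<le> Suc (len u)"
    using len_le[of "aff_refl s # ts"] ts ss'(2) u(2) by (auto simp: S_eq)
  moreover have "len u \<le> m"
    using len_le[OF ss'(3)] ss'(4) by (simp add: u_def)
  ultimately have m: "m = len u" using Suc(2) by simp
  have "aff_pos (aff_act u s)"
  proof (rule ccontr)
    assume "\<not> aff_pos (aff_act u s)"
    then obtain ts' where "set ts' \<subseteq> S" "Suc (length ts') = length ts" "word ts' = w"
      using exchange[OF ts(1) ss'(2)] ts(3) u(2) by auto
    then have "len w < len u"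
      using len_le[of ts'] ts(2) by simp
    then show False using m Suc(2) by simp
  qed
  then have "card (inversions w) = Suc (card (inversions u))"
    using card_inversions_step[OF u(1) ss'(2)] u(2) by simp
  then show ?case
    using Suc(1)[OF m u(1)] Suc(2) m by simp
qed

lemma finite_len: "finite {w \<in> W. len w = n}"
proof -
  have "{w \<in> W. len w = n} \<subseteq> word ` {ss. set ss \<subseteq> S \<and> length ss = n}"
    by (auto elim: reduced_word)
  then show ?thesis
    using finite_lists_length_eq[OF finite_S] by (meson finite_imageI finite_subset)
qed

end

section \<open>Sectors\<close>

context roots
begin

lemma grad_inverse:
  assumes "w \<in> W"
  shows "grad w (grad (inv\<^bsub>affine_weyl_group \<Phi>\<^esub> w) \<alpha>) = \<alpha>"
    and "grad (inv\<^bsub>affine_weyl_group \<Phi>\<^esub> w) (grad w \<alpha>) = \<alpha>"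
  using grad_comp[OF inv_W(1)[OF assms] assms] grad_comp[OF assms inv_W(1)[OF assms]]
    inv_W(2,3)[OF assms] grad_id by (metis comp_apply id_apply)+

lemma bij_grad: "w \<in> W \<Longrightarrow> bij (grad w)"
  using grad_inverse by (metis bijI')

lemma root_base_grad:
  assumes v: "v \<in> W" and B: "root_base \<Phi> B"
  shows "root_base \<Phi> (grad v ` B)"
proof -
  let ?g = "grad v"
  have lin: "linear ?g" and inj: "inj ?g" and surj: "surj ?g"
    using linear_grad[OF v] bij_grad[OF v] by (auto simp: bij_def)
  have comb: "?g (\<Sum>\<alpha>\<in>B. real (c \<alpha>) *\<^sub>R \<alpha>) = (\<Sum>b\<in>?g ` B. real (c (inv_into UNIV ?g b)) *\<^sub>R b)" for c :: "'v \<Rightarrow> nat"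
    using inj by (simp add: linear_sum[OF lin] linear_scale[OF lin] sum.reindex inj_on_subset o_def)
  show ?thesis
    unfolding root_base_def
  proof (intro conjI ballI)
    show "?g ` B \<subseteq> \<Phi>"
      using base_subset[OF B] grad_in[OF v] by auto
    show "independent (?g ` B)"
      using base_independent[OF B] linear_independent_injective_image[OF lin] inj
      by (blast intro: inj_on_subset)
    show "span (?g ` B) = UNIV"
      using linear_span_image[OF lin, of B] base_span[OF B] surj by simp
  next
    fix \<beta> assume "\<beta> \<in> \<Phi>"
    then obtain \<gamma> where \<gamma>: "\<gamma> \<in> \<Phi>" "\<beta> = ?g \<gamma>"
      using grad_image[OF v] by blast
    obtain c :: "'v \<Rightarrow> nat" where "\<gamma> = (\<Sum>\<alpha>\<in>B. real (c \<alpha>) *\<^sub>R \<alpha>) \<or> \<gamma> = - (\<Sum>\<alpha>\<in>B. real (c \<alpha>) *\<^sub>R \<alpha>)"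
      using B \<gamma>(1) unfolding root_base_def by blast
    then show "\<exists>c::'v \<Rightarrow> nat. \<beta> = (\<Sum>\<alpha>\<in>?g ` B. real (c \<alpha>) *\<^sub>R \<alpha>) \<or> \<beta> = - (\<Sum>\<alpha>\<in>?g ` B. real (c \<alpha>) *\<^sub>R \<alpha>)"
      using comb[of c] linear_neg[OF lin] \<gamma>(2) by metis
  qed
qed

text \<open>
  Restricting both components to the roots makes the sectors range over a finite set of functions.
\<close>

definition sector :: "('v dual \<Rightarrow> 'v dual) \<Rightarrow> ('v \<Rightarrow> 'v) \<times> ('v \<Rightarrow> real)" where
  "sector w = (restrict (grad w) \<Phi>, restrict (\<lambda>\<alpha>. sgn (pairing \<alpha> (w 0))) \<Phi>)"

lemma sector_eqI:
  assumes "grad u = grad w" "\<And>\<alpha>. \<alpha> \<in> \<Phi> \<Longrightarrow> sgn (pairing \<alpha> (u 0)) = sgn (pairing \<alpha> (w 0))"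
  shows "sector u = sector w"
  using assms by (auto simp: sector_def intro!: restrict_ext)

lemma
  assumes "u \<in> W" "w \<in> W" "sector u = sector w"
  shows sector_grad: "grad u = grad w"
    and sector_sgn: "\<alpha> \<in> \<Phi> \<Longrightarrow> sgn (pairing \<alpha> (u 0)) = sgn (pairing \<alpha> (w 0))"
proof -
  have "grad u \<alpha> = grad w \<alpha>" if "\<alpha> \<in> \<Phi>" for \<alpha>
    using fun_cong[OF arg_cong[OF assms(3), of fst], of \<alpha>] that by (simp add: sector_def)
  then show "grad u = grad w"
    using linear_eq_on_span[OF linear_grad linear_grad, OF assms(1,2), of \<Phi>] span_roots by auto
  show "\<alpha> \<in> \<Phi> \<Longrightarrow> sgn (pairing \<alpha> (u 0)) = sgn (pairing \<alpha> (w 0))"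
    using fun_cong[OF arg_cong[OF assms(3), of snd], of \<alpha>] by (simp add: sector_def)
qed

lemma finite_sectors: "finite (sector ` W)"
proof -
  have "sector ` W \<subseteq> (\<Phi> \<rightarrow>\<^sub>E \<Phi>) \<times> (\<Phi> \<rightarrow>\<^sub>E {-1, 0, 1})"
    using grad_in by (auto simp: sector_def sgn_real_def split: if_splits)
  then show ?thesis
    by (rule finite_subset) (intro finite_cartesian_product finite_PiE finite_roots; simp)
qed

lemma pairing_fixing_zero: "s \<in> W \<Longrightarrow> s 0 = 0 \<Longrightarrow> pairing \<alpha> (s x) = pairing (grad s \<alpha>) x"
  using pairing_W[of s x \<alpha>] by simp

lemma sector_left:
  assumes "u \<in> W" "w \<in> W" "sector u = sector w" "s \<in> W" "s 0 = 0"
  shows "sector (s \<circ> u) = sector (s \<circ> w)"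
  using sector_grad[OF assms(1-3)] sector_sgn[OF assms(1-3)] assms grad_in
  by (intro sector_eqI) (simp_all add: grad_comp pairing_fixing_zero)

lemma sector_right:
  assumes "u \<in> W" "w \<in> W" "sector u = sector w" "s \<in> W" "s 0 = 0"
  shows "sector (u \<circ> s) = sector (w \<circ> s)"
  using sector_grad[OF assms(1-3)] sector_sgn[OF assms(1-3)] assms
  by (intro sector_eqI) (simp_all add: grad_comp)

lemma sector_inverse:
  assumes "u \<in> W" "w \<in> W" "sector u = sector w"
  shows "sector (inv\<^bsub>affine_weyl_group \<Phi>\<^esub> u) = sector (inv\<^bsub>affine_weyl_group \<Phi>\<^esub> w)"
proof (rule sector_eqI)
  let ?i = "m_inv (affine_weyl_group \<Phi>)"
  show "grad (?i u) = grad (?i w)"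
    using sector_grad[OF assms] grad_inverse[OF assms(1)] grad_inverse[OF assms(2)] by (metis ext)
  have inv0: "pairing (grad x \<alpha>) (?i x 0) = - pairing \<alpha> (x 0)" if "x \<in> W" for x \<alpha>
  proof -
    have "x (?i x 0) = 0"
      using inv_W(3)[OF that] by (metis comp_apply id_apply)
    then show ?thesis
      using pairing_W[OF that, of "?i x 0" \<alpha>] by simp
  qed
  fix \<alpha> assume "\<alpha> \<in> \<Phi>"
  then obtain \<beta> where \<beta>: "\<beta> \<in> \<Phi>" "\<alpha> = grad w \<beta>"
    using grad_image[OF assms(2)] by blast
  have "sgn (pairing (grad w \<beta>) (?i u 0)) = sgn (pairing (grad w \<beta>) (?i w 0))"
    using inv0[OF assms(1), of \<beta>] inv0[OF assms(2), of \<beta>] sector_grad[OF assms] sector_sgn[OF assms \<beta>(1)]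
    by (simp add: sgn_minus)
  then show "sgn (pairing \<alpha> (?i u 0)) = sgn (pairing \<alpha> (?i w 0))"
    using \<beta>(2) by simp
qed

definition depth :: "'v dual \<Rightarrow> real" where
  "depth x = (\<Sum>\<alpha>\<in>\<Phi>. max 0 (- pairing \<alpha> x))"

lemma depth_invariant:
  assumes "s \<in> W" "s 0 = 0"
  shows "depth (s x) = depth x"
proof -
  have "inj_on (grad s) \<Phi>"
    using bij_grad[OF assms(1)] by (auto simp: bij_def intro: inj_on_subset)
  then have "(\<Sum>\<alpha>\<in>grad s ` \<Phi>. max 0 (- pairing \<alpha> x)) = (\<Sum>\<alpha>\<in>\<Phi>. max 0 (- pairing (grad s \<alpha>) x))"
    by (simp add: sum.reindex o_def)
  then show ?thesis
    using assms grad_image[OF assms(1)] by (simp add: depth_def pairing_fixing_zero)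
qed

text \<open>
  The conjugate is the reflection in \<open>(\<beta>, k)\<close> with \<open>\<beta> = grad x \<delta>\<close> and \<open>k = \<langle>\<delta>, x 0\<rangle>\<close>. It fixes
  the origin iff \<open>k = 0\<close>, which is visible in the sector, and then only \<open>\<beta>\<close> matters.
\<close>

lemma conj_fixing_zero:
  assumes "x \<in> W" "y \<in> W" "sector x = sector y" and \<delta>: "\<delta> \<in> \<Phi>"
    and s: "s = affine_reflection \<Phi> \<delta> 0"
    and fix0: "(inv\<^bsub>affine_weyl_group \<Phi>\<^esub> x \<circ> s \<circ> x) 0 = 0"
  shows "inv\<^bsub>affine_weyl_group \<Phi>\<^esub> x \<circ> s \<circ> x = inv\<^bsub>affine_weyl_group \<Phi>\<^esub> y \<circ> s \<circ> y"
proof -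
  let ?i = "m_inv (affine_weyl_group \<Phi>)" and ?a = "(\<delta>, 0 :: int)"
  have s': "s = aff_refl ?a" by (simp add: s aff_refl_def)
  have conj: "?i z \<circ> s \<circ> z = aff_refl (aff_act z ?a)" if z: "z \<in> W" for z
  proof -
    have "?i z \<circ> s \<circ> z = (?i z \<circ> z) \<circ> aff_refl (aff_act z ?a)"
      using aff_refl_conj[OF z, of ?a] \<delta> s' by (simp add: comp_assoc)
    then show ?thesis
      using inv_W(2)[OF z] by simp
  qed
  let ?\<beta> = "grad x \<delta>" let ?k = "\<lfloor>pairing \<delta> (x 0)\<rfloor>"
  have \<beta>: "?\<beta> \<in> \<Phi>" using grad_in assms by blast
  have "aff_refl (?\<beta>, ?k) 0 = 0"
    using fix0 conj[OF assms(1)] by (simp add: aff_act_def)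
  then have "pairing ?\<beta> (aff_refl (?\<beta>, ?k) 0) = 0"
    by simp
  then have "?k = 0"
    using \<beta> by (simp add: aff_refl_def pairing_affine_reflection)
  then have "pairing \<delta> (x 0) = 0"
    using floor_pairing_W[OF assms(1) \<delta>] by simp
  then have "pairing \<delta> (y 0) = 0"
    using sector_sgn[OF assms(1-3) \<delta>] by (simp add: sgn_0_0)
  then have "aff_act x ?a = aff_act y ?a"
    using \<open>?k = 0\<close> sector_grad[OF assms(1-3)] by (simp add: aff_act_def)
  then show ?thesis
    using conj assms by simp
qed

lemma sgn_sum_nonneg:
  fixes c y :: "'i \<Rightarrow> real"
  assumes "finite B" "\<And>b. b \<in> B \<Longrightarrow> c b \<ge> 0" "\<And>b. b \<in> B \<Longrightarrow> y b \<ge> 0"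
  shows "sgn (\<Sum>b\<in>B. c b * y b) = (if \<exists>b\<in>B. c b > 0 \<and> y b > 0 then 1 else 0)"
proof (cases "\<exists>b\<in>B. c b > 0 \<and> y b > 0")
  case True
  then obtain b where b: "b \<in> B" "c b * y b > 0" by auto
  have "c b * y b \<le> (\<Sum>b\<in>B. c b * y b)"
    using assms b by (intro member_le_sum) auto
  then show ?thesis using True b by simp
next
  case False
  then have "c b * y b = 0" if "b \<in> B" for b
    using assms(2,3)[OF that] that by (metis less_eq_real_def mult_eq_0_iff)
  then have "(\<Sum>b\<in>B. c b * y b) = 0"
    by (intro sum.neutral) blast
  then show ?thesis using False by simp
qed

text \<open>
  All coefficients of a root in the base have the same sign, so at a dominant point the sign of every
  root is determined by the set of basis roots that are positive there.
\<close>

lemma dominant_sector_eqI: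
  assumes B: "root_base \<Phi> B" and grad: "grad u = grad w"
    and dom: "\<And>b. b \<in> B \<Longrightarrow> pairing b (u 0) \<ge> 0" "\<And>b. b \<in> B \<Longrightarrow> pairing b (w 0) \<ge> 0"
    and pos: "\<And>b. b \<in> B \<Longrightarrow> pairing b (u 0) > 0 \<longleftrightarrow> pairing b (w 0) > 0"
  shows "sector u = sector w"
proof (rule sector_eqI[OF grad])
  fix \<alpha> assume \<alpha>: "\<alpha> \<in> \<Phi>"
  let ?c = "representation B \<alpha>"
  have expand: "pairing \<alpha> x = (\<Sum>b\<in>B. ?c b * pairing b x)" for x
    using arg_cong[OF base_expand[OF B, of \<alpha>], of "\<lambda>v. pairing v x"] by (simp add: pairing_linear)
  consider "\<forall>b\<in>B. ?c b \<ge> 0" | "\<forall>b\<in>B. ?c b \<le> 0"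
    using root_coef(1)[OF B \<alpha>] by blast
  then show "sgn (pairing \<alpha> (u 0)) = sgn (pairing \<alpha> (w 0))"
  proof cases
    case 1
    then show ?thesis
      unfolding expand using dom pos base_finite[OF B]
      by (subst (1 2) sgn_sum_nonneg) auto
  next
    case 2
    then have "sgn (\<Sum>b\<in>B. - ?c b * pairing b (u 0)) = sgn (\<Sum>b\<in>B. - ?c b * pairing b (w 0))"
      using dom pos base_finite[OF B] by (subst (1 2) sgn_sum_nonneg) auto
    then show ?thesis
      unfolding expand by (simp add: sum_negf sgn_minus)
  qed
qed

definition coweight :: "'v set \<Rightarrow> 'v \<Rightarrow> 'v dual" where
  "coweight B b = Blinfun (\<lambda>v. representation B v b)"

lemma pairing_coweight:
  assumes B: "root_base \<Phi> B"
  shows "pairing v (coweight B b) = representation B v b"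
proof -
  have "linear (\<lambda>v. representation B v b)"
    by (rule linearI) (simp_all add: coef_linear[OF B])
  then show ?thesis
    unfolding coweight_def by (simp add: linear_conv_bounded_linear bounded_linear_Blinfun_apply)
qed

end

section \<open>Length and growth of a sector\<close>

context affine_roots
begin

text \<open>
  While a simple root is negative at the point, reflecting in it reduces the number of positive roots
  that are negative there.
\<close>

lemma exists_dominant:
  "\<exists>v\<in>W. v 0 = 0 \<and> (\<forall>\<delta>\<in>\<Delta>. 0 \<le> pairing \<delta> (v x))"
proof (induction "card {\<alpha> \<in> \<Phi>. least_level \<alpha> = 0 \<and> pairing \<alpha> x < 0}" arbitrary: x rule: less_induct)
  case less
  show ?case
  proof (cases "\<forall>\<delta>\<in>\<Delta>. 0 \<le> pairing \<delta> x")
    case True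
    have "id \<in> W \<and> id (0 :: 'a dual) = 0 \<and> (\<forall>\<delta>\<in>\<Delta>. 0 \<le> pairing \<delta> (id x))"
      using W_id True by (metis id_apply)
    then show ?thesis by blast
  next
    case False
    then obtain \<delta> where \<delta>: "\<delta> \<in> \<Delta>" "pairing \<delta> x < 0" by force
    have \<delta>r: "\<delta> \<in> \<Phi>" using base_root \<delta> by blast
    let ?s = "affine_reflection \<Phi> \<delta> 0"
    let ?N = "\<lambda>x. {\<alpha> \<in> \<Phi>. least_level \<alpha> = 0 \<and> pairing \<alpha> x < 0}"
    have s: "?s \<in> W" "?s 0 = 0"
      using W_refl[OF \<delta>r] by (auto simp: affine_reflection_def)
    have p: "pairing \<alpha> (?s x) = pairing (root_refl \<delta> \<alpha>) x" for \<alpha>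
      using pairing_fixing_zero[OF s] grad_refl[OF \<delta>r] by simp
    have neg: "least_level (- \<delta>) = 1" and pos: "least_level \<delta> = 0"
      using \<delta>(1) least_level_minus[OF \<delta>r] by (auto simp: least_level_def coef_base[OF base])
    have "root_refl \<delta> ` ?N (?s x) \<subseteq> ?N x - {\<delta>}"
    proof (intro image_subsetI)
      fix \<alpha> assume \<alpha>: "\<alpha> \<in> ?N (?s x)"
      have ne: "\<alpha> \<noteq> \<delta>"
        using \<alpha> p[of \<delta>] \<delta>(2) \<delta>r by (auto simp: pairing_linear)
      have "aff_pos (aff_act (aff_refl (\<delta>, 0)) (\<alpha>, 0))"
        using \<alpha> ne \<delta>(1) by (intro simple_act_pos) (auto simp: simples_def aff_pos_def)
      moreover have "aff_act (aff_refl (\<delta>, 0)) (\<alpha>, 0) = (root_refl \<delta> \<alpha>, 0)"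
        using s(2) grad_refl[OF \<delta>r] by (simp add: aff_act_def aff_refl_def)
      ultimately have "least_level (root_refl \<delta> \<alpha>) = 0"
        by (auto simp: aff_pos_def least_level_def split: if_splits)
      moreover have "root_refl \<delta> \<alpha> \<noteq> \<delta>"
      proof
        assume "root_refl \<delta> \<alpha> = \<delta>"
        then have "\<alpha> = - \<delta>"
          using root_refl_involution[OF \<delta>r, of \<alpha>] \<delta>r by simp
        then show False using \<alpha> neg by simp
      qed
      ultimately show "root_refl \<delta> \<alpha> \<in> ?N x - {\<delta>}"
        using \<alpha> p root_refl_in[OF \<delta>r] by simp
    qed
    moreover have "inj_on (root_refl \<delta>) (?N (?s x))"
      by (rule inj_on_inverseI[of _ "root_refl \<delta>"]) (simp add: \<delta>r)
    moreover have "finite (?N x)" "\<delta> \<in> ?N x"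
      using finite_roots pos \<delta> \<delta>r by auto
    ultimately have "card (?N (?s x)) < card (?N x)"
      by (metis (no_types, lifting) card_Diff1_less card_image card_mono finite_Diff order_le_less_trans)
    then obtain v where v: "v \<in> W" "v 0 = 0" "\<forall>\<delta>\<in>\<Delta>. 0 \<le> pairing \<delta> (v (?s x))"
      using less by blast
    then show ?thesis
      using W_comp[OF v(1) s(1)] s(2) by (intro bexI[of _ "v \<circ> ?s"]) auto
  qed
qed

text \<open>
  Let \<open>m = \<langle>\<alpha>, w 0\<rangle>\<close> and let \<open>e\<close> be the change of \<open>least_level\<close> from \<open>\<alpha>\<close> to \<open>grad w \<alpha>\<close>. The
  inversions with gradient \<open>\<alpha>\<close> number \<open>max 0 (e - m)\<close>. As \<open>\<bar>e\<bar> \<le> 1\<close> and \<open>m\<close> is an integer, this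
  exceeds \<open>max 0 (- m)\<close> by an amount that depends only on \<open>e\<close> and the sign of \<open>m\<close>.
\<close>

definition sector_shift :: "('a \<Rightarrow> 'a) \<times> ('a \<Rightarrow> real) \<Rightarrow> real" where
  "sector_shift \<kappa> = (\<Sum>\<alpha>\<in>\<Phi>. let e = least_level (fst \<kappa> \<alpha>) - least_level \<alpha> in
     if snd \<kappa> \<alpha> = 1 then 0 else if snd \<kappa> \<alpha> = 0 then of_int (max 0 e) else of_int e)"

lemma len_eq_depth:
  assumes w: "w \<in> W"
  shows "real (len w) = depth (w 0) + sector_shift (sector w)"
proof -
  have "real (nat (least_level (grad w \<alpha>) - \<lfloor>pairing \<alpha> (w 0)\<rfloor> - least_level \<alpha>))
      = max 0 (- pairing \<alpha> (w 0)) + (let e = least_level (fst (sector w) \<alpha>) - least_level \<alpha> in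
     if snd (sector w) \<alpha> = 1 then 0 else if snd (sector w) \<alpha> = 0 then of_int (max 0 e) else of_int e)"
    if \<alpha>: "\<alpha> \<in> \<Phi>" for \<alpha>
  proof -
    obtain m where m: "pairing \<alpha> (w 0) = of_int m"
      using pairing_W_Ints[OF w \<alpha>] by (auto elim: Ints_cases)
    define e where "e = least_level (grad w \<alpha>) - least_level \<alpha>"
    have e: "e \<le> 1" "e \<ge> - 1" by (auto simp: e_def least_level_def)
    have "fst (sector w) \<alpha> = grad w \<alpha>" "snd (sector w) \<alpha> = sgn (real_of_int m)"
      using \<alpha> m by (auto simp: sector_def)
    moreover have "real (nat (e - m)) = max 0 (- real_of_int m) +
        (if sgn (real_of_int m) = 1 then 0 else if sgn (real_of_int m) = 0 then of_int (max 0 e) else of_int e)"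
      using e by (cases m "0 :: int" rule: linorder_cases) auto
    ultimately show ?thesis
      using m by (simp add: Let_def e_def algebra_simps)
  qed
  then show ?thesis
    by (simp add: len_eq_card_inversions[OF w] card_inversions[OF w] depth_def sector_shift_def sum.distrib)
qed

text \<open>
  Every root has the same weak sign at \<open>x\<close> and at the coweight, and \<open>max 0\<close> is additive on reals of
  equal sign.
\<close>

lemma depth_coweight:
  assumes B: "root_base \<Phi> B" and b: "b \<in> B" and x: "\<And>b. b \<in> B \<Longrightarrow> pairing b x \<ge> 0" and d: "d \<ge> 0"
  shows "depth (d *\<^sub>R coweight B b + x) = depth x + d * depth (coweight B b)"
proof -
  have "max 0 (- pairing \<alpha> (d *\<^sub>R coweight B b + x))
      = max 0 (- pairing \<alpha> x) + d * max 0 (- pairing \<alpha> (coweight B b))" if \<alpha>: "\<alpha> \<in> \<Phi>" for \<alpha>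
  proof -
    let ?c = "representation B \<alpha>"
    have expand: "pairing \<alpha> x = (\<Sum>b\<in>B. ?c b * pairing b x)"
      using arg_cong[OF base_expand[OF B, of \<alpha>], of "\<lambda>v. pairing v x"] by (simp add: pairing_linear)
    consider "\<forall>b\<in>B. ?c b \<ge> 0" | "\<forall>b\<in>B. ?c b \<le> 0"
      using root_coef(1)[OF B \<alpha>] by blast
    then show ?thesis
    proof cases
      case 1
      then have "0 \<le> pairing \<alpha> x"
        unfolding expand using x by (intro sum_nonneg) auto
      moreover have "0 \<le> d * ?c b" using 1 b d by auto
      ultimately show ?thesis
        using 1 b by (simp add: pairing_linear pairing_coweight[OF B])
    next
      case 2
      then have "pairing \<alpha> x \<le> 0"
        unfolding expand using x by (intro sum_nonpos) (auto intro: mult_nonpos_nonneg)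
      moreover have "d * ?c b \<le> 0" using 2 b d by (auto intro: mult_nonneg_nonpos)
      ultimately show ?thesis
        using 2 b by (simp add: pairing_linear pairing_coweight[OF B])
    qed
  qed
  then show ?thesis
    by (simp add: depth_def sum.distrib sum_distrib_left)
qed

lemma depth_coweight_nat:
  assumes B: "root_base \<Phi> B" and b: "b \<in> B"
  obtains e :: nat where "e > 0" "depth (coweight B b) = real e"
proof -
  have "depth (coweight B b) \<in> \<int>"
    unfolding depth_def using root_coef(2)[OF B _ b]
    by (intro Ints_sum) (auto simp: pairing_coweight[OF B] max_def)
  then obtain z where z: "depth (coweight B b) = of_int z" by (auto elim: Ints_cases)
  have "- b \<in> \<Phi>" using base_subset[OF B] b minus_root by blast
  then have "max 0 (- pairing (- b) (coweight B b)) \<le> depth (coweight B b)"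
    unfolding depth_def using finite_roots by (intro member_le_sum) auto
  then have "1 \<le> depth (coweight B b)"
    by (simp add: pairing_linear pairing_coweight[OF B] coef_base[OF B b])
  then show ?thesis
    using that[of "nat z"] z by simp
qed

text \<open>
  The set \<open>E\<close> indexes the edges of the cone. The sets \<open>X F\<close> consist of the elements of the sector whose
  coordinates at \<open>F \<subseteq> E\<close> are bounded by the step of the translation along that edge. Enlarging \<open>F\<close>
  by one edge removes the image of that translation, and \<open>X E\<close> is finite.
\<close>

proposition rational_growth_sector:
  assumes w0: "w0 \<in> W"
  shows "rational_fps (growth_series (affine_weyl_group \<Phi>) S {w \<in> W. sector w = sector w0})"
proof -
  obtain v where v: "v \<in> W" "v 0 = 0" "\<forall>\<delta>\<in>\<Delta>. 0 \<le> pairing \<delta> (v (w0 0))"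
    using exists_dominant by blast
  define B where "B = grad v ` \<Delta>"
  have B: "root_base \<Phi> B"
    unfolding B_def by (rule root_base_grad[OF v(1) base])
  define E where "E = {b \<in> B. pairing b (w0 0) > 0}"
  have finite_E: "finite E" and E_B: "E \<subseteq> B"
    using base_finite[OF B] by (auto simp: E_def)
  have dom0: "pairing b (w0 0) \<ge> 0" if "b \<in> B" for b
    using that v pairing_fixing_zero[OF v(1,2)] by (auto simp: B_def)
  have "\<exists>d::nat. d > 0 \<and> transl (of_nat d *\<^sub>R coweight B b) \<in> W" if "b \<in> B" for b
    using transl_multiple_W[of "coweight B b"] root_coef(2)[OF B _ that]
    by (metis pairing_coweight[OF B])
  then obtain d :: "'a \<Rightarrow> nat" where d: "\<And>b. b \<in> B \<Longrightarrow> d b > 0"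
      "\<And>b. b \<in> B \<Longrightarrow> transl (of_nat (d b) *\<^sub>R coweight B b) \<in> W"
    by metis
  define X where "X F = {w \<in> W. sector w = sector w0 \<and> (\<forall>b\<in>F. pairing b (w 0) \<le> d b)}" for F
  have dom: "pairing b (w 0) \<ge> 0" "pairing b (w 0) > 0 \<longleftrightarrow> b \<in> E" if "w \<in> X F" "b \<in> B" for w b F
  proof -
    have "sgn (pairing b (w 0)) = sgn (pairing b (w0 0))"
      using that sector_sgn[OF _ w0, of w b] base_subset[OF B] by (auto simp: X_def)
    then show "pairing b (w 0) \<ge> 0" "pairing b (w 0) > 0 \<longleftrightarrow> b \<in> E"
      using dom0[OF that(2)] that(2) by (auto simp: E_def sgn_real_def split: if_splits)
  qed
  (* Both directions along an edge are needed: forwards to shift the set into itself, backwards to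
     identify what the shift misses. *)
  have shift: "transl (c *\<^sub>R coweight B b) \<circ> w \<in> X F"
    if w: "w \<in> X F" and F: "F \<subseteq> E" and b: "b \<in> E" "b \<notin> F" and t: "transl (c *\<^sub>R coweight B b) \<in> W"
      and c: "pairing b (w 0) + c > 0" for w b F c
  proof -
    let ?w = "transl (c *\<^sub>R coweight B b) \<circ> w"
    have wW: "w \<in> W" "sector w = sector w0" using w by (auto simp: X_def)
    have p: "pairing b' (?w 0) = (if b' = b then pairing b (w 0) + c else pairing b' (w 0))" if "b' \<in> B" for b'
      using that by (auto simp: transl_def pairing_linear pairing_coweight[OF B] coef_base[OF B])
    have g: "grad ?w = grad w"
      using grad_comp[OF t wW(1)] by simp
    have "sector ?w = sector w"
    proof (rule dominant_sector_eqI[OF B g])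
      fix b' assume b': "b' \<in> B"
      show "pairing b' (?w 0) \<ge> 0" "pairing b' (w 0) \<ge> 0"
        using p[OF b'] dom[OF w b'] c by auto
      show "pairing b' (?w 0) > 0 \<longleftrightarrow> pairing b' (w 0) > 0"
        using p[OF b'] dom(2)[OF w b'] c b(1) by auto
    qed
    moreover have "pairing b' (?w 0) = pairing b' (w 0)" if "b' \<in> F" for b'
      using that p[of b'] F E_B b(2) by auto
    ultimately show ?thesis
      using w W_comp[OF t wW(1)] by (auto simp: X_def)
  qed
  have "rational_fps (growth_series (affine_weyl_group \<Phi>) S (X (E - D)))" if "finite D" "D \<subseteq> E" for D
    using that
  proof (induction D rule: finite_induct)
    case empty
    define f where "f w = restrict (\<lambda>b. pairing b (w 0)) B" for w :: "'a dual \<Rightarrow> 'a dual"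
    have "f ` X E \<subseteq> (\<Pi>\<^sub>E b\<in>B. real_of_int ` {0..int (d b)})"
    proof (intro image_subsetI PiE_I)
      fix w b assume w: "w \<in> X E" and b: "b \<in> B"
      have "b \<in> \<Phi>" "w \<in> W"
        using b base_subset[OF B] w by (auto simp: X_def)
      then obtain m where m: "pairing b (w 0) = of_int m"
        using pairing_W_Ints by (auto elim!: Ints_cases)
      have "pairing b (w 0) \<le> d b"
        using w dom[OF w b] by (cases "b \<in> E") (auto simp: X_def)
      then have "m \<in> {0..int (d b)}"
        using dom(1)[OF w b] m by simp
      then show "f w b \<in> real_of_int ` {0..int (d b)}"
        using b m by (auto simp: f_def)
    qed (auto simp: f_def)
    then have "finite (f ` X E)"
      using base_finite[OF B] by (meson finite_PiE finite_atLeastAtMost_int finite_imageI finite_subset)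
    moreover have "inj_on f (X E)"
    proof (rule inj_onI)
      fix u w assume uw: "u \<in> X E" "w \<in> X E" "f u = f w"
      have W: "u \<in> W" "w \<in> W" and "sector u = sector w"
        using uw by (auto simp: X_def)
      then have "grad u = grad w"
        using sector_grad by blast
      moreover have "u 0 = w 0"
        by (rule dual_eqI_spanning[OF base_span[OF B]]) (use uw(3) in \<open>metis f_def restrict_apply'\<close>)
      ultimately show "u = w"
        using W W_eqI by blast
    qed
    ultimately have "finite (X E)"
      using finite_imageD by blast
    then show ?case
      using rational_growth_series_finite by simp
  next
    case (insert b D)
    let ?F = "E - insert b D"
    let ?t = "of_nat (d b) *\<^sub>R coweight B b"
    let ?\<tau> = "\<lambda>w. transl ?t \<circ> w"
    have b: "b \<in> E" "b \<in> B" "b \<notin> ?F"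
      using insert.prems E_B by auto
    have F: "E - D = insert b ?F"
      using b insert.hyps by blast
    have inverse: "transl (- ?t) \<circ> (transl ?t \<circ> w) = w" "transl ?t \<circ> (transl (- ?t) \<circ> w) = w"
      for w :: "'a dual \<Rightarrow> 'a dual"
      by (auto simp: transl_def fun_eq_iff)
    obtain e :: nat where e: "e > 0" "depth (coweight B b) = real e"
      using depth_coweight_nat[OF B b(2)] by blast
    have shift_in: "?\<tau> w \<in> X ?F" if "w \<in> X ?F" for w
      using shift[OF that _ b(1,3) d(2)[OF b(2)]] dom(1)[OF that b(2)] d(1)[OF b(2)] by simp
    have p: "pairing b (?\<tau> w 0) = d b + pairing b (w 0)" for w
      by (simp add: transl_def pairing_linear pairing_coweight[OF B] coef_base[OF B b(2)])
    show ?case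
    proof (rule rational_growth_series_shift[where \<tau> = ?\<tau> and d = "d b * e"])
      show "finite {x \<in> X ?F. len x = n}" for n
        using finite_len[of n] by (rule rev_finite_subset) (auto simp: X_def)
      show "inj_on ?\<tau> (X ?F)"
        by (rule inj_on_inverseI[of _ "\<lambda>w. transl (- ?t) \<circ> w"]) (rule inverse)
      show "?\<tau> ` X ?F \<subseteq> X ?F"
        using shift_in by blast
      show "d b * e > 0"
        using d(1)[OF b(2)] e(1) by simp
    next
      fix w assume w: "w \<in> X ?F"
      have "sector (?\<tau> w) = sector w" "?\<tau> w \<in> W" "w \<in> W"
        using w shift_in[OF w] by (auto simp: X_def)
      then have "real (len (?\<tau> w)) = real (len w + d b * e)"
        using depth_coweight[OF B b(2), of "w 0" "d b"] dom(1)[OF w] e(2)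
        by (simp add: len_eq_depth transl_def)
      then show "len (?\<tau> w) = len w + d b * e"
        by (simp only: of_nat_eq_iff)
    next
      have "X ?F - ?\<tau> ` X ?F = X (insert b ?F)"
      proof (intro equalityI subsetI)
        fix w assume w: "w \<in> X ?F - ?\<tau> ` X ?F"
        have "pairing b (w 0) \<le> d b"
        proof (rule ccontr)
          assume "\<not> ?thesis"
          then have "transl (- of_nat (d b) *\<^sub>R coweight B b) \<circ> w \<in> X ?F"
            using w transl_minus_W[OF d(2)[OF b(2)]]
            by (intro shift[OF _ _ b(1,3)]) auto
          then have "transl (- ?t) \<circ> w \<in> X ?F" by simp
          then have "w \<in> ?\<tau> ` X ?F"
            using inverse(2)[of w] by (metis imageI)
          then show False using w by blast
        qed
        then show "w \<in> X (insert b ?F)"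
          using w by (auto simp: X_def)
      next
        fix w assume w: "w \<in> X (insert b ?F)"
        have "w \<notin> ?\<tau> ` X ?F"
        proof
          assume "w \<in> ?\<tau> ` X ?F"
          then obtain u where u: "u \<in> X ?F" "w = ?\<tau> u" by blast
          then have "pairing b (w 0) > d b"
            using p[of u] dom(2)[OF u(1) b(2)] b(1) by simp
          then show False
            using w by (simp add: X_def)
        qed
        then show "w \<in> X ?F - ?\<tau> ` X ?F"
          using w by (simp add: X_def)
      qed
      then show "rational_fps (growth_series (affine_weyl_group \<Phi>) S (X ?F - ?\<tau> ` X ?F))"
        using insert.IH insert.prems F by simp
    qed
  qed
  from this[OF finite_E] show ?thesis
    by (simp add: X_def)
qed

theorem rational_growth_sector_union:
  assumes X: "X \<subseteq> W" and sat: "\<And>u w. u \<in> X \<Longrightarrow> w \<in> W \<Longrightarrow> sector u = sector w \<Longrightarrow> w \<in> X"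
  shows "rational_fps (growth_series (affine_weyl_group \<Phi>) S X)"
proof -
  let ?C = "\<lambda>\<kappa>. {w \<in> W. sector w = \<kappa>}"
  have "X = (\<Union>\<kappa>\<in>sector ` X. ?C \<kappa>)"
    using X by (auto dest: sat)
  moreover have "rational_fps (growth_series (affine_weyl_group \<Phi>) S (\<Union>\<kappa>\<in>sector ` X. ?C \<kappa>))"
  proof (rule rational_growth_series_Union[where Y = W])
    show "finite (sector ` X)"
      using finite_sectors X by (meson finite_subset image_mono)
    show "disjoint_family_on ?C (sector ` X)"
      by (auto simp: disjoint_family_on_def)
    show "rational_fps (growth_series (affine_weyl_group \<Phi>) S (?C \<kappa>))" if "\<kappa> \<in> sector ` X" for \<kappa>
      using that X rational_growth_sector by auto
  qed (use finite_len in auto)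
  ultimately show ?thesis by simp
qed

section \<open>The three sets are unions of sectors\<close>

abbreviation G :: "('a dual \<Rightarrow> 'a dual) monoid" where
  "G \<equiv> affine_weyl_group \<Phi>"

lemma simple_reflectionD:
  assumes "s \<in> simple_reflections \<Phi> \<Delta>"
  obtains \<delta> where "\<delta> \<in> \<Phi>" "s = affine_reflection \<Phi> \<delta> 0" "s \<in> W" "s 0 = 0"
proof -
  obtain \<delta> where \<delta>: "\<delta> \<in> \<Delta>" "s = affine_reflection \<Phi> \<delta> 0"
    using assms by (auto simp: simple_reflections_def)
  moreover have "\<delta> \<in> \<Phi>"
    using base_root \<delta>(1) by blast
  moreover have "s \<in> W" "s 0 = 0"
    using W_refl[OF \<open>\<delta> \<in> \<Phi>\<close>] \<delta>(2) by (auto simp: affine_reflection_def)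
  ultimately show ?thesis using that by blast
qed

text \<open>
  The depth terms on the two sides cancel, as finite reflections preserve the depth.
\<close>

lemma len_compare_left:
  assumes "u \<in> W" "w \<in> W" "sector u = sector w" "s \<in> W" "s 0 = 0"
  shows "len u < len (s \<circ> u) \<longleftrightarrow> len w < len (s \<circ> w)"
proof -
  have "len x < len (s \<circ> x) \<longleftrightarrow> sector_shift (sector x) < sector_shift (sector (s \<circ> x))" if "x \<in> W" for x
    by (subst of_nat_less_iff[where 'a = real, symmetric])
       (simp only: len_eq_depth that W_comp assms(4) comp_apply depth_invariant[OF assms(4,5)]
          add_less_cancel_left)
  then show ?thesis
    using assms sector_left[OF assms] by simp
qed

lemma len_compare_right:
  assumes "u \<in> W" "w \<in> W" "sector u = sector w" "s \<in> W" "s 0 = 0"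
  shows "len u < len (u \<circ> s) \<longleftrightarrow> len w < len (w \<circ> s)"
proof -
  have "len x < len (x \<circ> s) \<longleftrightarrow> sector_shift (sector x) < sector_shift (sector (x \<circ> s))" if "x \<in> W" for x
    by (subst of_nat_less_iff[where 'a = real, symmetric])
       (simp only: len_eq_depth that W_comp assms(4,5) comp_apply add_less_cancel_left)
  then show ?thesis
    using assms sector_right[OF assms] by simp
qed

lemma min_double_coset_reps_sector:
  assumes J: "J \<subseteq> simple_reflections \<Phi> \<Delta>" and K: "K \<subseteq> simple_reflections \<Phi> \<Delta>"
    and u: "u \<in> min_double_coset_reps G S J K" and w: "w \<in> W" "sector u = sector w"
  shows "w \<in> min_double_coset_reps G S J K"
proof -
  have uW: "u \<in> W" using u by (simp add: min_double_coset_reps_def W_def)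
  have "len w < len (s \<otimes>\<^bsub>G\<^esub> w)" if "s \<in> J" for s
  proof -
    have s: "s \<in> W" "s 0 = 0"
      using simple_reflectionD J \<open>s \<in> J\<close> by blast+
    have "len u < len (s \<otimes>\<^bsub>G\<^esub> u)"
      using u that by (simp add: min_double_coset_reps_def)
    then show ?thesis
      using len_compare_left[OF uW w s] mult_W[OF s(1)] uW w(1) by simp
  qed
  moreover have "len w < len (w \<otimes>\<^bsub>G\<^esub> s)" if "s \<in> K" for s
  proof -
    have s: "s \<in> W" "s 0 = 0"
      using simple_reflectionD K \<open>s \<in> K\<close> by blast+
    have "len u < len (u \<otimes>\<^bsub>G\<^esub> s)"
      using u that by (simp add: min_double_coset_reps_def)
    then show ?thesis
      using len_compare_right[OF uW w s] mult_W[OF _ s(1)] uW w(1) by simp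
  qed
  ultimately show ?thesis
    using w(1) by (simp add: min_double_coset_reps_def W_def)
qed

lemma conj_fixing_zero_mult:
  assumes x: "x \<in> W" and y: "y \<in> W" and xy: "sector x = sector y"
    and s: "s \<in> simple_reflections \<Phi> \<Delta>" and fix0: "(inv\<^bsub>G\<^esub> x \<otimes>\<^bsub>G\<^esub> s \<otimes>\<^bsub>G\<^esub> x) 0 = 0"
  shows "inv\<^bsub>G\<^esub> x \<otimes>\<^bsub>G\<^esub> s \<otimes>\<^bsub>G\<^esub> x = inv\<^bsub>G\<^esub> y \<otimes>\<^bsub>G\<^esub> s \<otimes>\<^bsub>G\<^esub> y"
proof -
  obtain \<delta> where \<delta>: "\<delta> \<in> \<Phi>" "s = affine_reflection \<Phi> \<delta> 0" "s \<in> W"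
    using simple_reflectionD[OF s] by blast
  have "inv\<^bsub>G\<^esub> z \<otimes>\<^bsub>G\<^esub> s \<otimes>\<^bsub>G\<^esub> z = inv\<^bsub>G\<^esub> z \<circ> s \<circ> z" if "z \<in> W" for z
    using that \<delta>(3) inv_W(1)[OF that] W_comp by (simp add: mult_W)
  then show ?thesis
    using conj_fixing_zero[OF x y xy \<delta>(1,2)] x y fix0 by metis
qed

lemma p_set_sector:
  assumes J: "J \<subseteq> simple_reflections \<Phi> \<Delta>" and K: "K \<subseteq> simple_reflections \<Phi> \<Delta>"
    and u: "u \<in> p_set G S Q J K" and w: "w \<in> W" "sector u = sector w"
  shows "w \<in> p_set G S Q J K"
proof -
  let ?f = "\<lambda>x s. inv\<^bsub>G\<^esub> x \<otimes>\<^bsub>G\<^esub> s \<otimes>\<^bsub>G\<^esub> x"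
  have u': "u \<in> min_double_coset_reps G S J K" "K \<inter> ?f u ` J = Q"
    using u by (auto simp: p_set_def)
  have uW: "u \<in> W" using u' by (simp add: min_double_coset_reps_def W_def)
  have "K \<inter> ?f x ` J \<subseteq> K \<inter> ?f y ` J" if xy: "x \<in> W" "y \<in> W" "sector x = sector y" for x y
  proof
    fix k assume "k \<in> K \<inter> ?f x ` J"
    then obtain s where s: "s \<in> J" "k = ?f x s" and k: "k \<in> K" by blast
    have "k 0 = 0"
      using simple_reflectionD K k by blast
    then have "?f x s = ?f y s"
      using s J by (intro conj_fixing_zero_mult[OF xy]) auto
    then show "k \<in> K \<inter> ?f y ` J"
      using s k by auto
  qed
  then have "K \<inter> ?f w ` J = K \<inter> ?f u ` J"
    using uW w by (metis subset_antisym)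
  then show ?thesis
    using u' min_double_coset_reps_sector[OF J K u'(1) w] by (simp add: p_set_def)
qed

text \<open>
  If \<open>u\<close> normalizes the subgroup then its conjugates of the generators fix the origin, so \<open>w\<close>
  conjugates the generators, and hence the whole subgroup, in the same way.
\<close>

lemma normalizer_sector:
  assumes J: "J \<subseteq> simple_reflections \<Phi> \<Delta>"
    and u: "u \<in> normalizer G (generate G J)" and w: "w \<in> W" "sector u = sector w"
  shows "w \<in> normalizer G (generate G J)"
proof -
  interpret group G by (rule W_is_group)
  let ?H = "generate G J"
  have JW: "J \<subseteq> carrier G"
    using simple_reflectionD J unfolding W_def by blast
  have H: "?H \<subseteq> carrier G"
    using generate_incl[OF JW] .
  have normalizer: "x \<in> normalizer G ?H \<longleftrightarrow> x \<in> carrier G \<and> (\<lambda>h. x \<otimes>\<^bsub>G\<^esub> h \<otimes>\<^bsub>G\<^esub> inv\<^bsub>G\<^esub> x) ` ?H = ?H" for x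
    using H by (auto simp: normalizer_def stabilizer_def l_coset_def r_coset_def)
  have uG: "u \<in> carrier G" and wG: "w \<in> carrier G" and uW: "u \<in> W"
    using u w normalizer by (auto simp: W_def)
  have fix0: "h 0 = 0" if "h \<in> ?H" for h
    using that
  proof induction
    case one
    show ?case by (simp add: one_W)
  next
    case (incl s)
    then show ?case using simple_reflectionD J by blast
  next
    case (inv s)
    then have s: "s \<in> W" "s 0 = 0"
      using simple_reflectionD J by blast+
    then show ?case
      using inv_W(2)[OF s(1)] by (metis comp_apply id_apply)
  next
    case (eng g h)
    then have "g \<in> W" "h \<in> W" using H by (auto simp: W_def)
    then show ?case using eng by (simp add: mult_W)
  qed
  have conj_gen: "u \<otimes>\<^bsub>G\<^esub> s \<otimes>\<^bsub>G\<^esub> inv\<^bsub>G\<^esub> u = w \<otimes>\<^bsub>G\<^esub> s \<otimes>\<^bsub>G\<^esub> inv\<^bsub>G\<^esub> w" if s: "s \<in> J" for s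
  proof -
    have "u \<otimes>\<^bsub>G\<^esub> s \<otimes>\<^bsub>G\<^esub> inv\<^bsub>G\<^esub> u \<in> ?H"
      using u s normalizer generate.incl[of s J G] by blast
    then have "(inv\<^bsub>G\<^esub> (inv\<^bsub>G\<^esub> u) \<otimes>\<^bsub>G\<^esub> s \<otimes>\<^bsub>G\<^esub> inv\<^bsub>G\<^esub> u) 0 = 0"
      using fix0 uG by simp
    then have "inv\<^bsub>G\<^esub> (inv\<^bsub>G\<^esub> u) \<otimes>\<^bsub>G\<^esub> s \<otimes>\<^bsub>G\<^esub> inv\<^bsub>G\<^esub> u = inv\<^bsub>G\<^esub> (inv\<^bsub>G\<^esub> w) \<otimes>\<^bsub>G\<^esub> s \<otimes>\<^bsub>G\<^esub> inv\<^bsub>G\<^esub> w"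
      using s J inv_W(1) uW w sector_inverse[OF uW w] by (intro conj_fixing_zero_mult) auto
    then show ?thesis using uG wG by simp
  qed
  let ?c = "\<lambda>x h. x \<otimes>\<^bsub>G\<^esub> h \<otimes>\<^bsub>G\<^esub> inv\<^bsub>G\<^esub> x"
  have c_inv: "?c x (inv\<^bsub>G\<^esub> h) = inv\<^bsub>G\<^esub> (?c x h)" if "x \<in> carrier G" "h \<in> carrier G" for x h
    using that by (simp add: inv_mult_group m_assoc)
  have c_mult: "?c x (g \<otimes>\<^bsub>G\<^esub> h) = ?c x g \<otimes>\<^bsub>G\<^esub> ?c x h"
    if "x \<in> carrier G" "g \<in> carrier G" "h \<in> carrier G" for x g h
    using that by (simp add: m_assoc inv_solve_left)
  have "?c u h = ?c w h" if "h \<in> ?H" for h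
    using that
  proof induction
    case one
    show ?case using uG wG by simp
  next
    case (incl s)
    then show ?case using conj_gen by blast
  next
    case (inv s)
    then have "s \<in> carrier G" using JW by blast
    then show ?case
      using conj_gen[OF inv] c_inv[OF uG] c_inv[OF wG] by simp
  next
    case (eng g h)
    then have "g \<in> carrier G" "h \<in> carrier G" using H by blast+
    then show ?case
      using eng.IH c_mult[OF uG] c_mult[OF wG] by simp
  qed
  then have "?c w ` ?H = ?c u ` ?H"
    by (intro image_cong) auto
  then show ?thesis
    using u normalizer wG by simp
qed

end

theorem theorem2:
  fixes \<Phi> \<Delta> :: "'v::euclidean_space set" and \<theta> :: 'v
    and Q J K :: "('v dual \<Rightarrow> 'v dual) set"
  defines "W \<equiv> affine_weyl_group \<Phi>"
    and "S \<equiv> affine_simple_reflections \<Phi> \<Delta> \<theta>"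
  assumes "irreducible_root_system \<Phi>" and "reduced_root_system \<Phi>"
    and "root_base \<Phi> \<Delta>" and "highest_root \<Phi> \<Delta> \<theta>"
    and "Q \<subseteq> simple_reflections \<Phi> \<Delta>"
    and "J \<subseteq> simple_reflections \<Phi> \<Delta>"
    and "K \<subseteq> simple_reflections \<Phi> \<Delta>"
  shows "rational_fps (growth_series W S (p_set W S Q J K)) \<and>
         rational_fps (growth_series W S (min_double_coset_reps W S J K)) \<and>
         rational_fps (growth_series W S (normalizer W (generate W J)))"
proof -
  interpret A: affine_roots \<Phi> \<Delta> \<theta>
    using assms(4-6) by unfold_locales (auto simp: reduced_root_system_def)
  have "p_set W S Q J K \<subseteq> A.W" "min_double_coset_reps W S J K \<subseteq> A.W"
    "normalizer W (generate W J) \<subseteq> A.W"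
    by (auto simp: A.W_def W_def p_set_def min_double_coset_reps_def normalizer_def stabilizer_def)
  note subset = this[unfolded W_def S_def]
  show ?thesis
    unfolding W_def S_def
  proof (intro conjI A.rational_growth_sector_union subset)
    fix u w assume w: "w \<in> A.W" "A.sector u = A.sector w"
    show "w \<in> p_set (affine_weyl_group \<Phi>) A.S Q J K"
      if "u \<in> p_set (affine_weyl_group \<Phi>) A.S Q J K"
      using A.p_set_sector[OF assms(8,9) that w] .
    show "w \<in> min_double_coset_reps (affine_weyl_group \<Phi>) A.S J K"
      if "u \<in> min_double_coset_reps (affine_weyl_group \<Phi>) A.S J K"
      using A.min_double_coset_reps_sector[OF assms(8,9) that w] .
    show "w \<in> normalizer (affine_weyl_group \<Phi>) (generate (affine_weyl_group \<Phi>) J)"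
      if "u \<in> normalizer (affine_weyl_group \<Phi>) (generate (affine_weyl_group \<Phi>) J)"
      using A.normalizer_sector[OF assms(8) that w] .
  qed
qed

end
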